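(* Let $L$ be an infeasible linear pencil of size $m$ (i.e. $S_L=\emptyset$). Then $$-1\in M_L^{(2^{m-1}-1)}.$$
   Context: $\mathbb{R}[X]=\mathbb{R}[X_1,\dots,X_n]$, and $\mathbb{R}[X]_k$ is the space of polynomials of degree at most $k$. A linear pencil of size $m$ in $n$ variables is a symmetric $m\times m$ matrix $L=A_0+\sum_{i=1}^n X_iA_i$ with $A_0,\dots,A_n$ real symmetric $m\times m$ matrices. $A^*$ denotes the transpose, and $A\succeq0$ means that $A$ is real symmetric positive semidefinite. $S_L=\{x\in\mathbb{R}^n\mid L(x)\succeq0\}$; $L$ is infeasible if $S_L=\emptyset$. For an integer $k\ge0$, the truncated quadratic module is $$M_L^{(k)}=\Big\{\sum_i p_i^2+\sum_j v_j^*Lv_j\ \Big|\ p_i\in\mathbb{R}[X]_k,\ v_j\in(\mathbb{R}[X]_k)^m\Big\}\subseteq\mathbb{R}[X]_{2k+1}$$ (all sums finite). *)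

theory Defs
  imports "HOL-Library.Poly_Mapping" "Jordan_Normal_Form.Matrix"
begin

text \<open>
  A polynomial is a finitely supported map from monomials to coefficients, where a monomial is a
  finitely supported map from variable indices to exponents; the ring structure is the convolution
  product provided for \<^typ>\<open>(nat \<Rightarrow>\<^sub>0 nat) \<Rightarrow>\<^sub>0 real\<close> by \<^theory>\<open>HOL-Library.Poly_Mapping\<close>.
  The type has infinitely many variables; the polynomial ring in \<open>n\<close> variables consists of those
  polynomials that involve only the variables with index \<open>0, \<dots>, n - 1\<close>.
\<close>

type_synonym rpoly = "(nat \<Rightarrow>\<^sub>0 nat) \<Rightarrow>\<^sub>0 real"

definition Const :: "real \<Rightarrow> rpoly" where
  "Const c = Poly_Mapping.single 0 c"

definition Var :: "nat \<Rightarrow> rpoly" where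
  "Var i = Poly_Mapping.single (Poly_Mapping.single i 1) 1"

definition monom_deg :: "(nat \<Rightarrow>\<^sub>0 nat) \<Rightarrow> nat" where
  "monom_deg t = (\<Sum>i\<in>Poly_Mapping.keys t. Poly_Mapping.lookup t i)"

definition polys_upto :: "nat \<Rightarrow> nat \<Rightarrow> rpoly set" where
  "polys_upto n k = {p. \<forall>t\<in>Poly_Mapping.keys p. Poly_Mapping.keys t \<subseteq> {..<n} \<and> monom_deg t \<le> k}"

definition poly_eval :: "rpoly \<Rightarrow> real vec \<Rightarrow> real" where
  "poly_eval p x = (\<Sum>t\<in>Poly_Mapping.keys p. Poly_Mapping.lookup p t * (\<Prod>i\<in>Poly_Mapping.keys t. (x $ i) ^ Poly_Mapping.lookup t i))"

definition sym_mat :: "nat \<Rightarrow> real mat \<Rightarrow> bool" where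
  "sym_mat m A \<longleftrightarrow> A \<in> carrier_mat m m \<and> transpose_mat A = A"

definition psd :: "real mat \<Rightarrow> bool" where
  "psd A \<longleftrightarrow> sym_mat (dim_row A) A \<and> (\<forall>v\<in>carrier_vec (dim_row A). 0 \<le> v \<bullet> (A *\<^sub>v v))"

text \<open>The polynomial matrix \<open>A0 + X\<^sub>0 A\<^sub>0 + \<dots> + X\<^sub>n\<^sub>-\<^sub>1 A\<^sub>n\<^sub>-\<^sub>1\<close>, given entrywise;
  the variables are numbered from \<open>0\<close>, and the constant coefficient \<open>A0\<close> is kept separate.\<close>

definition pencil_of :: "nat \<Rightarrow> nat \<Rightarrow> real mat \<Rightarrow> (nat \<Rightarrow> real mat) \<Rightarrow> rpoly mat" where
  "pencil_of n m A0 A =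
     mat m m (\<lambda>(i, j). Const (A0 $$ (i, j)) + (\<Sum>l<n. Var l * Const (A l $$ (i, j))))"

definition linear_pencil :: "nat \<Rightarrow> nat \<Rightarrow> rpoly mat \<Rightarrow> bool" where
  "linear_pencil n m L \<longleftrightarrow>
     (\<exists>A0 A. sym_mat m A0 \<and> (\<forall>l<n. sym_mat m (A l)) \<and> L = pencil_of n m A0 A)"

definition pencil_eval :: "rpoly mat \<Rightarrow> real vec \<Rightarrow> real mat" where
  "pencil_eval L x = map_mat (\<lambda>p. poly_eval p x) L"

definition spectrahedron :: "nat \<Rightarrow> rpoly mat \<Rightarrow> real vec set" where
  "spectrahedron n L = {x \<in> carrier_vec n. psd (pencil_eval L x)}"

definition trunc_quadratic_module :: "nat \<Rightarrow> nat \<Rightarrow> rpoly mat \<Rightarrow> nat \<Rightarrow> rpoly set" where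
  "trunc_quadratic_module n m L k =
     {(\<Sum>p\<leftarrow>ps. p ^ 2) + (\<Sum>v\<leftarrow>vs. v \<bullet> (L *\<^sub>v v)) | ps vs.
        set ps \<subseteq> polys_upto n k \<and>
        set vs \<subseteq> {v \<in> carrier_vec m. \<forall>i<m. v $ i \<in> polys_upto n k}}"

lemma poly_eval_superset:
  assumes "finite S" "Poly_Mapping.keys p \<subseteq> S"
  shows "poly_eval p x = (\<Sum>t\<in>S. Poly_Mapping.lookup p t * (\<Prod>i\<in>Poly_Mapping.keys t. (x $ i) ^ Poly_Mapping.lookup t i))"
  unfolding poly_eval_def
  by (rule sum.mono_neutral_left) (use assms in \<open>auto simp: Poly_Mapping.in_keys_iff\<close>)

lemma poly_eval_add: "poly_eval (p + q) x = poly_eval p x + poly_eval q x"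
proof -
  let ?S = "Poly_Mapping.keys p \<union> Poly_Mapping.keys q"
  have "Poly_Mapping.keys (p + q) \<subseteq> ?S" by (rule Poly_Mapping.keys_add)
  then show ?thesis
    by (simp add: poly_eval_superset[of ?S] Poly_Mapping.lookup_add distrib_right sum.distrib)
qed

lemma poly_eval_0: "poly_eval 0 x = 0"
  by (simp add: poly_eval_def)

lemma poly_eval_sum: "poly_eval (\<Sum>l\<in>S. f l) x = (\<Sum>l\<in>S. poly_eval (f l) x)"
  by (induction S rule: infinite_finite_induct) (simp_all add: poly_eval_0 poly_eval_add)

lemma poly_eval_Const: "poly_eval (Const c) x = c"
  by (cases "c = 0") (simp_all add: poly_eval_def Const_def)

lemma poly_eval_Var_Const: "poly_eval (Var l * Const c) x = x $ l * c"
  by (cases "c = 0") (simp_all add: poly_eval_def Const_def Var_def Poly_Mapping.mult_single)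

lemma pencil_eval_pencil_of:
  "pencil_eval (pencil_of n m A0 A) x =
     mat m m (\<lambda>(i, j). A0 $$ (i, j) + (\<Sum>l<n. x $ l * A l $$ (i, j)))"
  by (rule eq_matI)
     (simp_all add: pencil_eval_def pencil_of_def poly_eval_add poly_eval_sum poly_eval_Const
        poly_eval_Var_Const)

end

theory Submission
  imports Defs "HOL-Analysis.Function_Topology"
begin

text \<open>
  Let \<open>L\<close> be infeasible. The affine space of all \<open>L(x)\<close> misses the cone of positive semidefinite
  matrices, and a hyperplane separating the two yields a nonzero positive semidefinite \<open>B\<close> for which
  \<open>tr (B L)\<close> is a constant \<open>c \<le> 0\<close>. Since \<open>B\<close> is a sum of matrices \<open>u u\<^sup>T\<close>, the polynomial
  \<open>tr (B L)\<close> is a sum of terms \<open>u\<^sup>T L u\<close>. If \<open>c < 0\<close>, rescaling gives a certificate with constant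
  vectors. If \<open>c = 0\<close>, then for some \<open>u \<noteq> 0\<close> both \<open>u\<^sup>T L u\<close> and \<open>- u\<^sup>T L u\<close> lie in the quadratic
  module. Every feasible point would then satisfy the linear equations \<open>L u = 0\<close>; and where these
  hold, \<open>v\<^sup>T L v\<close> does not change when a multiple of \<open>u\<close> is added to \<open>v\<close>, so that an index \<open>s\<close> with
  \<open>u\<^sub>s \<noteq> 0\<close> may be deleted from the pencil. This is one step of facial reduction.

  The step is iterated by keeping a finite set \<open>E\<close> of affine equations next to the pencil
  (\<open>alternative\<close>, \<open>restrict_infeasible\<close>). A certificate for the smaller pencil involves multiples
  \<open>q (L u)\<^sub>j\<close> of the new equations, and these are removed by means of
  the identity \<open>q (L u)\<^sub>j = w\<^sup>T L w - (q/2)\<^sup>2 u\<^sup>T L u - L\<^sub>j\<^sub>j\<close> with \<open>w = (q/2) u + e\<^sub>j\<close>.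
  The first two terms on the right are in the module; the third is the reason why the induction is not
  about \<open>-1\<close> but about all affine polynomials \<open>f\<close>: the induction hypothesis is applied to
  \<open>f - (\<Sum>j. L\<^sub>j\<^sub>j)\<close> (\<open>absorb_equations\<close>).

  The vector \<open>w\<close> has the degree of \<open>q\<close>, and \<open>(q/2)\<^sup>2\<close> doubles the degree of the multipliers of the old
  equations. Hence each deleted index doubles the degree. A certificate for \<open>-1\<close> with constant vectors
  represents every affine \<open>f\<close> in degree 1, because \<open>f = (f/2 + 1)\<^sup>2 - 1 - (f/2)\<^sup>2\<close>. Degree 1 also
  suffices for all infeasible pencils of size 2 (\<open>affine_certificate_size_two\<close>): either the
  certificate for the remaining diagonal entry lifts by completing a square to one with
  constant vectors, or it uses the equations only, whose multipliers then need degree 1 instead of 2.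
  Starting from size 2, the doubling gives degree \<open>2\<^sup>m\<^sup>-\<^sup>2\<close>, which is at most \<open>2\<^sup>m\<^sup>-\<^sup>1 - 1\<close>. In size 1
  the degree is 0, and a pencil of size 0 is feasible.
\<close>

section \<open>Separation of a convex set from the origin\<close>

lemma compact_box_fun: "compact {f :: 'j \<Rightarrow> real. \<forall>j. a \<le> f j \<and> f j \<le> b}"
proof -
  have "compactin (product_topology (\<lambda>_::'j. euclidean :: real topology) UNIV) (PiE UNIV (\<lambda>_. {a..b}))"
    by (simp add: compactin_PiE)
  moreover have "PiE UNIV (\<lambda>_. {a..b}) = {f :: 'j \<Rightarrow> real. \<forall>j. a \<le> f j \<and> f j \<le> b}"
    by (auto simp: PiE_def Pi_def)
  ultimately show ?thesis
    by (simp add: euclidean_product_topology)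
qed

lemma convex_combination_mem:
  fixes S :: "('j \<Rightarrow> real) set"
  assumes conv: "\<And>x y t. x \<in> S \<Longrightarrow> y \<in> S \<Longrightarrow> 0 \<le> t \<Longrightarrow> t \<le> 1 \<Longrightarrow> (\<lambda>j. (1 - t) * x j + t * y j) \<in> S"
    and "finite F" "F \<subseteq> S" "\<And>x. x \<in> F \<Longrightarrow> 0 \<le> t x" "(\<Sum>x\<in>F. t x) = 1"
  shows "(\<lambda>j. \<Sum>x\<in>F. t x * x j) \<in> S"
  using assms(2-)
proof (induction F arbitrary: t rule: finite_induct)
  case empty
  then show ?case by simp
next
  case (insert y F)
  define s where "s = (\<Sum>x\<in>F. t x)"
  have s: "t y = 1 - s" "0 \<le> s"
    using insert by (auto simp: s_def intro: sum_nonneg)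
  have s1: "s \<le> 1" using s insert.prems(2)[of y] by simp
  show ?case
  proof (cases "s = 0")
    case True
    have "\<forall>x\<in>F. t x = 0"
      using True insert.prems(2) insert.hyps(1) by (simp add: s_def sum_nonneg_eq_0_iff)
    then have "(\<lambda>j. \<Sum>x\<in>insert y F. t x * x j) = y"
      using insert.hyps s True by (auto simp: fun_eq_iff)
    then show ?thesis using insert.prems by simp
  next
    case False
    have "(\<lambda>j. \<Sum>x\<in>F. (t x / s) * x j) \<in> S"
    proof (rule insert.IH)
      show "(\<Sum>x\<in>F. t x / s) = 1"
        using False by (simp add: s_def flip: sum_divide_distrib)
    qed (use insert.prems s in auto)
    from conv[OF _ this s(2) s1, of y]
    have "(\<lambda>j. (1 - s) * y j + s * (\<Sum>x\<in>F. (t x / s) * x j)) \<in> S"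
      using insert.prems by simp
    also have "(\<lambda>j. (1 - s) * y j + s * (\<Sum>x\<in>F. (t x / s) * x j)) = (\<lambda>j. \<Sum>x\<in>insert y F. t x * x j)"
      using insert.hyps False s by (auto simp: fun_eq_iff sum_distrib_left)
    finally show ?thesis .
  qed
qed

text \<open>
  The variational inequality for a point \<open>z\<close> of minimal norm, with \<open>zz\<close>, \<open>zx\<close>, \<open>xx\<close> standing for the
  inner products of \<open>z\<close> and \<open>x\<close>: the squared norm of \<open>(1 - s) z + s x\<close> has a nonnegative derivative
  at \<open>s = 0\<close>.
\<close>
lemma nearest_point_inequality:
  fixes zz zx xx :: real
  assumes "\<And>s. 0 < s \<Longrightarrow> s \<le> 1 \<Longrightarrow> zz \<le> (1 - s)^2 * zz + 2 * s * (1 - s) * zx + s^2 * xx"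
  shows "zz \<le> zx"
proof (rule ccontr)
  assume "\<not> zz \<le> zx"
  define e where "e = zz - zx"
  have e: "e > 0" using \<open>\<not> zz \<le> zx\<close> by (simp add: e_def)
  \<comment> \<open>Along the segment the squared norm is \<open>zz - 2 e s + (zz - 2 zx + xx) s\<^sup>2\<close>; at \<open>s = e / M\<close> the linear
    term dominates, and \<open>M \<ge> e\<close> keeps \<open>s\<close> in the unit interval.\<close>
  define M where "M = \<bar>zz - 2 * zx + xx\<bar> + e"
  have M: "M > 0" "e \<le> M" using e by (auto simp: M_def)
  define s where "s = e / M"
  have s: "0 < s" "s \<le> 1" using e M by (auto simp: s_def)
  have "0 \<le> s * (- 2 * e + s * (zz - 2 * zx + xx))"
    using assms[OF s] by (simp add: e_def power2_eq_square algebra_simps)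
  then have "2 * e \<le> s * (zz - 2 * zx + xx)"
    using s by (simp add: zero_le_mult_iff)
  also have "\<dots> \<le> s * M"
    using s e by (intro mult_left_mono) (auto simp: M_def)
  also have "\<dots> = e" using M by (simp add: s_def)
  finally show False using e by simp
qed

text \<open>
  The convex hull of \<open>F\<close> is compact, since it is the image of the simplex of weights. It avoids the
  origin, so its point of minimal norm is a nonzero normal vector.
\<close>
lemma separate_finite:
  fixes S :: "('j \<Rightarrow> real) set"
  assumes J: "finite J"
    and conv: "\<And>x y t. x \<in> S \<Longrightarrow> y \<in> S \<Longrightarrow> 0 \<le> t \<Longrightarrow> t \<le> 1 \<Longrightarrow> (\<lambda>j. (1 - t) * x j + t * y j) \<in> S"
    and nz: "\<And>x. x \<in> S \<Longrightarrow> \<exists>j\<in>J. x j \<noteq> 0"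
    and F: "finite F" "F \<subseteq> S" "F \<noteq> {}"
  shows "\<exists>a. (\<exists>j\<in>J. a j \<noteq> 0) \<and> (\<forall>x\<in>F. 0 \<le> (\<Sum>j\<in>J. a j * x j))"
proof -
  \<comment> \<open>Weights are total functions; confining them to the unit interval also outside \<open>F\<close> makes \<open>D\<close> compact
    in the product topology. The same is done for the coordinates outside \<open>J\<close> in the next proof.\<close>
  define D where "D = {t :: ('j \<Rightarrow> real) \<Rightarrow> real. \<forall>x. 0 \<le> t x \<and> t x \<le> 1} \<inter> {t. (\<Sum>x\<in>F. t x) = 1}"
  define c where "c = (\<lambda>t j. \<Sum>x\<in>F. t x * (x j :: real))"
  have cont: "continuous_on A (\<lambda>t :: ('j \<Rightarrow> real) \<Rightarrow> real. t x)" for A x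
    by (rule continuous_on_product_coordinates[THEN continuous_on_subset]) simp
  have "compact D"
    unfolding D_def
    by (intro compact_Int_closed compact_box_fun closed_Collect_eq continuous_intros cont)
  moreover obtain x0 where x0: "x0 \<in> F" using F by blast
  have "(\<lambda>x. if x = x0 then 1 else 0) \<in> D"
    using F x0 by (auto simp: D_def)
  then have "D \<noteq> {}" by blast
  moreover have "continuous_on D (\<lambda>t. \<Sum>j\<in>J. (c t j)\<^sup>2)"
    unfolding c_def by (intro continuous_intros cont)
  ultimately obtain t where t: "t \<in> D" "\<And>t'. t' \<in> D \<Longrightarrow> (\<Sum>j\<in>J. (c t j)\<^sup>2) \<le> (\<Sum>j\<in>J. (c t' j)\<^sup>2)"
    using continuous_attains_inf[of D] by blast
  have "c t \<in> S"
    unfolding c_def using t(1) F by (intro convex_combination_mem conv) (auto simp: D_def)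
  then obtain j where j: "j \<in> J" "c t j \<noteq> 0" using nz by blast
  have "(\<Sum>j\<in>J. (c t j)\<^sup>2) \<le> (\<Sum>j\<in>J. c t j * x j)" if x: "x \<in> F" for x
  proof (rule nearest_point_inequality[where xx = "\<Sum>j\<in>J. (x j)\<^sup>2"])
    fix s :: real assume s: "0 < s" "s \<le> 1"
    define t' where "t' = (\<lambda>y. (1 - s) * t y + s * (if y = x then 1 else 0))"
    have b: "0 \<le> t y" "t y \<le> 1" for y using t(1) by (auto simp: D_def)
    have "(1 - s) * t y + s * (if y = x then 1 else 0) \<le> (1 - s) * 1 + s * 1" for y
      using s b by (intro add_mono mult_left_mono) auto
    then have "t' \<in> D"
      using t(1) s x F b
      by (auto simp: D_def t'_def sum.distrib simp flip: sum_distrib_left)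
    moreover have "c t' j = (1 - s) * c t j + s * x j" for j
    proof -
      have "c t' j = (\<Sum>y\<in>F. (1 - s) * (t y * y j) + s * (if y = x then y j else 0))"
        unfolding c_def t'_def by (intro sum.cong) (auto simp: algebra_simps)
      also have "\<dots> = (1 - s) * c t j + s * x j"
        using x F by (simp add: sum.distrib c_def flip: sum_distrib_left)
      finally show ?thesis .
    qed
    ultimately have "(\<Sum>j\<in>J. (c t j)\<^sup>2) \<le> (\<Sum>j\<in>J. ((1 - s) * c t j + s * x j)\<^sup>2)"
      using t(2) by force
    also have "\<dots> = (1 - s)^2 * (\<Sum>j\<in>J. (c t j)\<^sup>2) + 2 * s * (1 - s) * (\<Sum>j\<in>J. c t j * x j) + s^2 * (\<Sum>j\<in>J. (x j)\<^sup>2)"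
      by (simp add: sum_distrib_left power2_eq_square algebra_simps flip: sum.distrib)
    finally show "(\<Sum>j\<in>J. (c t j)\<^sup>2) \<le> (1 - s)^2 * (\<Sum>j\<in>J. (c t j)\<^sup>2) + 2 * s * (1 - s) * (\<Sum>j\<in>J. c t j * x j) + s^2 * (\<Sum>j\<in>J. (x j)\<^sup>2)" .
  qed
  then have "0 \<le> (\<Sum>j\<in>J. c t j * x j)" if "x \<in> F" for x
    using that by (meson order_trans sum_nonneg zero_le_power2)
  then show ?thesis using j by blast
qed

text \<open>
  The set \<open>S\<close> may have the origin in its closure, so a nearest point need not exist. Instead, the unit
  vectors \<open>a\<close> with \<open>a \<bullet> x \<ge> 0\<close> form a closed subset of the compact unit sphere for each \<open>x\<close>; finitely
  many of these subsets meet by the preceding lemma, hence all of them do. Vectors are functions on an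
  index set, because the dimension will depend on the sizes of the pencil and of the set of equations.
\<close>
lemma separate_from_origin:
  fixes S :: "('j \<Rightarrow> real) set"
  assumes J: "finite J"
    and conv: "\<And>x y t. x \<in> S \<Longrightarrow> y \<in> S \<Longrightarrow> 0 \<le> t \<Longrightarrow> t \<le> 1 \<Longrightarrow> (\<lambda>j. (1 - t) * x j + t * y j) \<in> S"
    and nz: "\<And>x. x \<in> S \<Longrightarrow> \<exists>j\<in>J. x j \<noteq> 0"
    and "S \<noteq> {}"
  obtains a where "\<exists>j\<in>J. a j \<noteq> 0" "\<And>x. x \<in> S \<Longrightarrow> 0 \<le> (\<Sum>j\<in>J. a j * x j)"
proof -
  define K where "K = {a :: 'j \<Rightarrow> real. \<forall>j. -1 \<le> a j \<and> a j \<le> 1} \<inter> {a. (\<Sum>j\<in>J. (a j)\<^sup>2) = 1}"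
  define H where "H = (\<lambda>x. {a :: 'j \<Rightarrow> real. 0 \<le> (\<Sum>j\<in>J. a j * x j)})"
  have cont: "continuous_on A (\<lambda>a :: 'j \<Rightarrow> real. a j)" for A j
    by (rule continuous_on_product_coordinates[THEN continuous_on_subset]) simp
  have compact: "compact K"
    unfolding K_def
    by (intro compact_Int_closed compact_box_fun closed_Collect_eq continuous_intros cont)
  have closed: "closed (H x)" for x
    unfolding H_def by (intro closed_Collect_le continuous_intros cont)
  have fip: "K \<inter> \<Inter> (H ` F) \<noteq> {}" if F: "finite F" "F \<subseteq> S" for F
  proof -
    obtain x0 where x0: "x0 \<in> S" using \<open>S \<noteq> {}\<close> by blast
    obtain a where a: "\<exists>j\<in>J. a j \<noteq> 0" "\<forall>x\<in>insert x0 F. 0 \<le> (\<Sum>j\<in>J. a j * x j)"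
    proof -
      have "\<exists>a. (\<exists>j\<in>J. a j \<noteq> 0) \<and> (\<forall>x\<in>insert x0 F. 0 \<le> (\<Sum>j\<in>J. a j * x j))"
        by (rule separate_finite[OF J conv nz]) (use F x0 in simp_all)
      then show thesis using that by blast
    qed
    define r where "r = (\<Sum>j\<in>J. (a j)\<^sup>2)"
    have r: "r > 0" using a(1) J unfolding r_def by (metis sum_pos2 zero_le_power2 zero_less_power2)
    define b where "b = (\<lambda>j. if j \<in> J then a j / sqrt r else 0)"
    have b1: "(\<Sum>j\<in>J. (b j)\<^sup>2) = 1"
      using r by (simp add: b_def power_divide r_def flip: sum_divide_distrib)
    have "\<bar>b j\<bar> \<le> 1" for j
    proof (cases "j \<in> J")
      case True
      then have "(b j)\<^sup>2 \<le> 1"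
        using b1 J by (metis member_le_sum zero_le_power2)
      then show ?thesis by (simp add: abs_square_le_1)
    qed (simp add: b_def)
    then have "b \<in> K" using b1 by (auto simp: K_def abs_le_iff minus_le_iff)
    moreover have "b \<in> H x" if "x \<in> F" for x
    proof -
      have "(\<Sum>j\<in>J. b j * x j) = (\<Sum>j\<in>J. a j * x j) / sqrt r"
        by (simp add: b_def sum_divide_distrib)
      then show ?thesis using a(2) that r by (simp add: H_def)
    qed
    ultimately show ?thesis by blast
  qed
  have "K \<inter> \<Inter> (H ` S) \<noteq> {}"
    by (rule compact_imp_fip_image[OF compact closed fip])
  then obtain a where a: "a \<in> K" "\<And>x. x \<in> S \<Longrightarrow> a \<in> H x" by blast
  have "\<exists>j\<in>J. a j \<noteq> 0"
  proof (rule ccontr)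
    assume "\<not> ?thesis"
    then have "(\<Sum>j\<in>J. (a j)\<^sup>2) = 0" by simp
    with \<open>a \<in> K\<close> show False by (simp add: K_def)
  qed
  moreover have "0 \<le> (\<Sum>j\<in>J. a j * x j)" if "x \<in> S" for x
    using a(2)[OF that] by (simp add: H_def)
  ultimately show thesis by (rule that)
qed

section \<open>Polynomials of bounded degree and affine polynomials\<close>

lemma Const_0 [simp]: "Const 0 = 0"
  and Const_1 [simp]: "Const 1 = 1"
  and Const_add: "Const (a + b) = Const a + Const b"
  and Const_mult: "Const (a * b) = Const a * Const b"
  and Const_minus: "Const (- a) = - Const a"
  and Const_diff: "Const (a - b) = Const a - Const b"
  by (simp_all add: Const_def single_add mult_single single_diff single_uminus)

lemma Const_power: "Const (a ^ k) = Const a ^ k"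
  by (induction k) (simp_all add: Const_mult)

lemma monom_deg_superset:
  assumes "finite A" "Poly_Mapping.keys t \<subseteq> A"
  shows "monom_deg t = (\<Sum>i\<in>A. Poly_Mapping.lookup t i)"
  unfolding monom_deg_def
  by (rule sum.mono_neutral_left) (use assms in \<open>auto simp: in_keys_iff\<close>)

lemma monom_deg_add: "monom_deg (s + t) = monom_deg s + monom_deg t"
proof -
  let ?A = "Poly_Mapping.keys s \<union> Poly_Mapping.keys t"
  have "Poly_Mapping.keys (s + t) \<subseteq> ?A" by (rule keys_add)
  then show ?thesis
    by (simp add: monom_deg_superset[of ?A] lookup_add sum.distrib)
qed

lemma polys_upto_mono: "p \<in> polys_upto n k \<Longrightarrow> k \<le> l \<Longrightarrow> p \<in> polys_upto n l"
  by (fastforce simp: polys_upto_def)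

lemma Const_polys_upto [simp]: "Const c \<in> polys_upto n k"
  by (simp add: Const_def polys_upto_def monom_deg_def)

lemma zero_polys_upto [simp]: "0 \<in> polys_upto n k"
  and one_polys_upto [simp]: "1 \<in> polys_upto n k"
  using Const_polys_upto[of 0] Const_polys_upto[of 1] by simp_all

lemma polys_upto_add: "p \<in> polys_upto n k \<Longrightarrow> q \<in> polys_upto n k \<Longrightarrow> p + q \<in> polys_upto n k"
  using keys_add[of p q] by (auto simp: polys_upto_def)

lemma polys_upto_mult:
  assumes "p \<in> polys_upto n k" "q \<in> polys_upto n l"
  shows "p * q \<in> polys_upto n (k + l)"
proof -
  have "Poly_Mapping.keys (s + t) \<subseteq> {..<n} \<and> monom_deg (s + t) \<le> k + l"
    if "s \<in> Poly_Mapping.keys p" "t \<in> Poly_Mapping.keys q" for s t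
    using that assms keys_add[of s t]
    by (fastforce simp: polys_upto_def monom_deg_add intro: add_mono)
  then show ?thesis
    using keys_mult[of p q] unfolding polys_upto_def by blast
qed

lemma polys_upto_Const_mult: "p \<in> polys_upto n k \<Longrightarrow> Const c * p \<in> polys_upto n k"
  using polys_upto_mult[OF Const_polys_upto[of c n 0]] by fastforce

lemma polys_upto_sum: "(\<And>i. i \<in> A \<Longrightarrow> f i \<in> polys_upto n k) \<Longrightarrow> sum f A \<in> polys_upto n k"
  by (induction A rule: infinite_finite_induct) (simp_all add: polys_upto_add)

lemma Var_polys_upto: "l < n \<Longrightarrow> Var l \<in> polys_upto n 1"
  by (simp add: Var_def polys_upto_def monom_deg_def)

lemma polys_upto_0_iff: "p \<in> polys_upto n 0 \<longleftrightarrow> (\<exists>c. p = Const c)"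
proof
  assume p: "p \<in> polys_upto n 0"
  have "t = 0" if "t \<in> Poly_Mapping.keys p" for t
  proof -
    have "(\<Sum>i\<in>Poly_Mapping.keys t. Poly_Mapping.lookup t i) = 0"
      using p that by (auto simp: polys_upto_def monom_deg_def)
    then show ?thesis by (intro poly_mapping_eqI) (auto simp: in_keys_iff)
  qed
  then have "p = Const (Poly_Mapping.lookup p 0)"
    by (intro poly_mapping_eqI) (metis Const_def in_keys_iff lookup_single_eq lookup_single_not_eq)
  then show "\<exists>c. p = Const c" ..
qed auto

definition affine_polys :: "nat \<Rightarrow> rpoly set" where
  "affine_polys n = {Const c + (\<Sum>l<n. Var l * Const (a l)) | c a. True}"

lemma affine_polysE:
  assumes "p \<in> affine_polys n"
  obtains c a where "p = Const c + (\<Sum>l<n. Var l * Const (a l))"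
  using assms by (auto simp: affine_polys_def)

lemma affine_polysI: "Const c + (\<Sum>l<n. Var l * Const (a l)) \<in> affine_polys n"
  by (auto simp: affine_polys_def)

lemma Const_affine [simp]: "Const c \<in> affine_polys n"
  using affine_polysI[of c "\<lambda>_. 0" n] by simp

lemma zero_affine [simp]: "0 \<in> affine_polys n"
  using Const_affine[of 0] by simp

lemma affine_add:
  assumes "p \<in> affine_polys n" "q \<in> affine_polys n"
  shows "p + q \<in> affine_polys n"
proof -
  obtain c a d b where "p = Const c + (\<Sum>l<n. Var l * Const (a l))" "q = Const d + (\<Sum>l<n. Var l * Const (b l))"
    using assms by (elim affine_polysE)
  then have "p + q = Const (c + d) + (\<Sum>l<n. Var l * Const (a l + b l))"
    by (simp add: Const_add distrib_left sum.distrib)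
  then show ?thesis by (metis affine_polysI)
qed

lemma Const_mult_affine_form:
  "Const d * (Const c + (\<Sum>l<n. Var l * Const (a l))) = Const (d * c) + (\<Sum>l<n. Var l * Const (d * a l))"
  by (simp add: Const_mult distrib_left sum_distrib_left mult.left_commute)

lemma affine_Const_mult: "p \<in> affine_polys n \<Longrightarrow> Const d * p \<in> affine_polys n"
  by (elim affine_polysE) (simp only: Const_mult_affine_form affine_polysI)

lemma affine_minus: "p \<in> affine_polys n \<Longrightarrow> - p \<in> affine_polys n"
  using affine_Const_mult[of p n "-1"] by (simp add: Const_minus)

lemma affine_sum: "(\<And>i. i \<in> A \<Longrightarrow> f i \<in> affine_polys n) \<Longrightarrow> sum f A \<in> affine_polys n"
  by (induction A rule: infinite_finite_induct) (simp_all add: affine_add)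

lemma affine_polys_upto: "p \<in> affine_polys n \<Longrightarrow> p \<in> polys_upto n 1"
proof (elim affine_polysE)
  fix c a assume p: "p = Const c + (\<Sum>l<n. Var l * Const (a l))"
  have "Const (a l) * Var l \<in> polys_upto n 1" if "l < n" for l
    using that by (intro polys_upto_Const_mult Var_polys_upto)
  then show ?thesis
    unfolding p by (intro polys_upto_add polys_upto_sum) (auto simp: mult.commute)
qed

lemma poly_eval_affine_form:
  "poly_eval (Const c + (\<Sum>l<n. Var l * Const (a l))) x = c + (\<Sum>l<n. vec_index x l * a l)"
  by (simp add: poly_eval_add poly_eval_sum poly_eval_Const poly_eval_Var_Const)

lemma poly_eval_Const_mult:
  assumes "p \<in> affine_polys n"
  shows "poly_eval (Const d * p) x = d * poly_eval p x"
proof -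
  obtain c a where p: "p = Const c + (\<Sum>l<n. Var l * Const (a l))"
    using assms by (rule affine_polysE)
  show ?thesis
    unfolding p Const_mult_affine_form poly_eval_affine_form
    by (simp add: distrib_left sum_distrib_left mult.left_commute)
qed

lemma poly_eval_affine_convex:
  assumes "p \<in> affine_polys n" "x \<in> carrier_vec n" "y \<in> carrier_vec n"
  shows "poly_eval p (vec n (\<lambda>l. (1 - t) * vec_index x l + t * vec_index y l)) = (1 - t) * poly_eval p x + t * poly_eval p y"
proof -
  obtain c a where p: "p = Const c + (\<Sum>l<n. Var l * Const (a l))"
    using assms(1) by (rule affine_polysE)
  have "(\<Sum>l<n. ((1 - t) * vec_index x l + t * vec_index y l) * a l)
     = (1 - t) * (\<Sum>l<n. vec_index x l * a l) + t * (\<Sum>l<n. vec_index y l * a l)"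
    unfolding sum_distrib_left sum.distrib[symmetric] by (intro sum.cong) (simp_all add: algebra_simps)
  moreover have "(\<Sum>l<n. vec_index (vec n (\<lambda>l. (1 - t) * vec_index x l + t * vec_index y l)) l * a l)
     = (\<Sum>l<n. ((1 - t) * vec_index x l + t * vec_index y l) * a l)"
    by (intro sum.cong) simp_all
  ultimately show ?thesis
    unfolding p poly_eval_affine_form by (simp add: algebra_simps)
qed

lemma linear_bounded_above_imp_zero:
  fixes a c :: real
  assumes "\<And>t. c + t * a \<le> 0"
  shows "a = 0"
proof (rule ccontr)
  assume "a \<noteq> 0"
  with assms[of "(1 - c) / a"] show False by simp
qed

text \<open>An affine function that is bounded above on the whole space has no linear part.\<close>
lemma affine_nonpos_imp_Const:
  assumes "p \<in> affine_polys n" "\<And>x. x \<in> carrier_vec n \<Longrightarrow> poly_eval p x \<le> 0"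
  obtains c where "c \<le> 0" "p = Const c"
proof -
  obtain c a where p: "p = Const c + (\<Sum>l<n. Var l * Const (a l))"
    using assms(1) by (rule affine_polysE)
  have "a k = 0" if "k < n" for k
  proof (rule linear_bounded_above_imp_zero[of c])
    fix t :: real
    have "(\<Sum>l<n. vec_index (vec n (\<lambda>l. if l = k then t else 0)) l * a l) = (\<Sum>l<n. if l = k then t * a l else 0)"
      by (intro sum.cong) auto
    with assms(2)[of "vec n (\<lambda>l. if l = k then t else 0)"] that
    show "c + t * a k \<le> 0" by (simp add: p poly_eval_affine_form)
  qed
  then have "p = Const c" unfolding p by simp
  moreover have "c \<le> 0"
    using assms(2)[of "vec n (\<lambda>_. 0)"] \<open>p = Const c\<close> by (simp add: poly_eval_Const)
  ultimately show thesis using that by blast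
qed

section \<open>Bilinear forms and positive semidefinite matrices\<close>

definition apply_form :: "('i \<Rightarrow> 'i \<Rightarrow> 'a::comm_ring_1) \<Rightarrow> 'i set \<Rightarrow> ('i \<Rightarrow> 'a) \<Rightarrow> 'i \<Rightarrow> 'a" where
  "apply_form M I v i = (\<Sum>j\<in>I. M i j * v j)"

definition bform :: "('i \<Rightarrow> 'i \<Rightarrow> 'a::comm_ring_1) \<Rightarrow> 'i set \<Rightarrow> ('i \<Rightarrow> 'a) \<Rightarrow> ('i \<Rightarrow> 'a) \<Rightarrow> 'a" where
  "bform M I u v = (\<Sum>i\<in>I. u i * apply_form M I v i)"

definition unit_fun :: "'i \<Rightarrow> 'i \<Rightarrow> 'a::comm_ring_1" where
  "unit_fun j = (\<lambda>i. if i = j then 1 else 0)"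

lemma bform_add_left: "bform M I (\<lambda>i. u i + w i) v = bform M I u v + bform M I w v"
  and bform_add_right: "bform M I v (\<lambda>i. u i + w i) = bform M I v u + bform M I v w"
  and bform_scale_left: "bform M I (\<lambda>i. a * u i) v = a * bform M I u v"
  and bform_scale_right: "bform M I v (\<lambda>i. a * u i) = a * bform M I v u"
  by (simp_all add: bform_def apply_form_def algebra_simps sum.distrib sum_distrib_left)

lemma bform_expand: "bform M I u v = (\<Sum>i\<in>I. \<Sum>j\<in>I. u i * M i j * v j)"
  by (simp add: bform_def apply_form_def sum_distrib_left mult.assoc)

lemma bform_commute:
  assumes "\<forall>i\<in>I. \<forall>j\<in>I. M i j = M j i"
  shows "bform M I u v = bform M I v u"
proof -
  have "bform M I u v = (\<Sum>j\<in>I. \<Sum>i\<in>I. u i * M i j * v j)"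
    unfolding bform_expand by (rule sum.swap)
  also have "\<dots> = bform M I v u"
    unfolding bform_expand by (intro sum.cong) (use assms in \<open>auto simp: algebra_simps\<close>)
  finally show ?thesis .
qed

lemma bform_unit_left: "finite I \<Longrightarrow> j \<in> I \<Longrightarrow> bform M I (unit_fun j) v = apply_form M I v j"
  by (simp add: bform_def unit_fun_def if_distrib[of "\<lambda>x. x * _"] cong: if_cong)

lemma apply_form_unit: "finite I \<Longrightarrow> j \<in> I \<Longrightarrow> apply_form M I (unit_fun j) i = M i j"
  by (simp add: apply_form_def unit_fun_def if_distrib[of "\<lambda>x. _ * x"] cong: if_cong)

lemma bform_combine:
  assumes "\<forall>i\<in>I. \<forall>j\<in>I. M i j = M j i"
  shows "bform M I (\<lambda>i. a * u i + w i) (\<lambda>i. a * u i + w i)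
    = a\<^sup>2 * bform M I u u + 2 * a * bform M I w u + bform M I w w"
  unfolding bform_add_left bform_add_right bform_scale_left bform_scale_right
  by (simp add: bform_commute[OF assms, of u w] power2_eq_square algebra_simps)

lemma bform_cong:
  "(\<And>i. i \<in> I \<Longrightarrow> u i = u' i) \<Longrightarrow> (\<And>i. i \<in> I \<Longrightarrow> v i = v' i) \<Longrightarrow> bform M I u v = bform M I u' v'"
  by (simp add: bform_expand)

text \<open>
  Principal submatrices are treated as restrictions of one matrix to smaller index sets; extending
  vectors by zero turns forms on the submatrix into forms on the whole matrix.
\<close>
lemma bform_extend:
  assumes "finite I" "I' \<subseteq> I"
  shows "bform M I (\<lambda>i. if i \<in> I' then u i else 0) (\<lambda>i. if i \<in> I' then v i else 0) = bform M I' u v"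
proof -
  have "apply_form M I (\<lambda>i. if i \<in> I' then v i else 0) i = apply_form M I' v i" for i
    unfolding apply_form_def by (rule sum.mono_neutral_cong_right) (use assms in auto)
  then show ?thesis
    unfolding bform_def by (intro sum.mono_neutral_cong_right) (use assms in auto)
qed

lemma bform_matrix_combination:
  "bform (\<lambda>i j. a * M i j + b * N i j) I v v = a * bform M I v v + b * bform N I v v"
  unfolding bform_expand sum_distrib_left sum.distrib[symmetric]
  by (intro sum.cong) (simp_all add: algebra_simps)

text \<open>
  Otherwise the form would be affine and nonconstant, hence unbounded below, along the line of vectors
  \<open>t e\<^sub>i + e\<^sub>j\<close>.
\<close>
lemma psd_zero_diagonal:
  fixes B :: "'i \<Rightarrow> 'i \<Rightarrow> real"
  assumes "finite I" "\<forall>i\<in>I. \<forall>j\<in>I. B i j = B j i" "\<And>v. 0 \<le> bform B I v v"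
    and "i \<in> I" "j \<in> I" "B i i = 0"
  shows "B i j = 0"
proof -
  have "- B j j + t * (- 2 * B i j) \<le> 0" for t
    using assms(3)[of "\<lambda>k. t * unit_fun i k + unit_fun j k"]
    unfolding bform_combine[of I B, OF assms(2)]
    using assms(1,2,4-6) by (simp add: bform_unit_left apply_form_unit)
  then have "- 2 * B i j = 0" by (rule linear_bounded_above_imp_zero)
  then show ?thesis by simp
qed

text \<open>
  One step of a Cholesky decomposition. Subtracting the rank-one matrix built from row \<open>i\<close>, with
  \<open>B i i > 0\<close>, is the substitution \<open>v \<mapsto> v - (B v)\<^sub>i / B\<^sub>i\<^sub>i e\<^sub>i\<close> in the form, so semidefiniteness is
  preserved; it clears the \<open>i\<close>-th diagonal entry and keeps the zeros of the diagonal.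
\<close>
lemma psd_peel:
  fixes B :: "'i \<Rightarrow> 'i \<Rightarrow> real"
  assumes "finite I" and sym: "\<forall>i\<in>I. \<forall>j\<in>I. B i j = B j i"
    and psd: "\<And>v. 0 \<le> bform B I v v"
    and "i \<in> I" "j \<in> I" "B i j \<noteq> 0"
  obtains u where "\<exists>s\<in>I. u s \<noteq> 0" "\<And>v. 0 \<le> bform (\<lambda>i j. B i j - u i * u j) I v v"
    "{k\<in>I. B k k - u k * u k \<noteq> 0} \<subset> {k\<in>I. B k k \<noteq> 0}"
proof -
  have nz: "B i i \<noteq> 0" using psd_zero_diagonal[OF assms(1-5)] assms(6) by blast
  have "0 \<le> B i i" using psd[of "unit_fun i"] assms by (simp add: bform_unit_left apply_form_unit)
  with nz have pos: "B i i > 0" by simp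
  define u where "u = (\<lambda>k. B i k / sqrt (B i i))"
  have uu: "u k * u l = B i k * B i l / B i i" for k l
    using pos by (simp add: u_def)
  have psd': "0 \<le> bform (\<lambda>k l. B k l - u k * u l) I v v" for v
  proof -
    define c where "c = apply_form B I v i"
    have c: "c = (\<Sum>k\<in>I. B i k * v k)" by (simp add: c_def apply_form_def)
    have "bform (\<lambda>k l. B k l - u k * u l) I v v = bform B I v v - c\<^sup>2 / B i i"
      unfolding bform_expand c power2_eq_square sum_product sum_divide_distrib sum_subtractf[symmetric]
      by (intro sum.cong) (simp_all add: uu algebra_simps)
    also have "\<dots> = bform B I (\<lambda>k. (- c / B i i) * unit_fun i k + v k) (\<lambda>k. (- c / B i i) * unit_fun i k + v k)"
      unfolding bform_combine[of I B, OF sym]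
      using assms nz by (simp add: bform_unit_left apply_form_unit bform_commute[OF sym, of v "unit_fun i"]
          power2_eq_square field_simps flip: c_def)
    finally show ?thesis using psd by simp
  qed
  have "B k k \<noteq> 0" if "k \<in> I" "B k k - u k * u k \<noteq> 0" for k
  proof
    assume "B k k = 0"
    moreover from this have "B i k = 0"
      using psd_zero_diagonal[OF assms(1-3), of k i] sym that(1) assms(4) by simp
    ultimately show False using that by (simp add: u_def)
  qed
  moreover have "B i i - u i * u i = 0" using nz by (simp add: uu)
  ultimately have "{k\<in>I. B k k - u k * u k \<noteq> 0} \<subset> {k\<in>I. B k k \<noteq> 0}"
    using nz assms(4) by blast
  moreover have "u i \<noteq> 0" using pos by (simp add: u_def)
  ultimately show thesis using that psd' assms(4) by blast
qed

section \<open>Truncated quadratic modules with additional equations\<close>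

text \<open>
  The quadratic module of the pencil restricted to the index set \<open>I\<close>, enlarged by the ideal generated by
  the equations \<open>E\<close> and truncated: squares and vectors have degree at most \<open>D\<close>, multipliers of equations
  degree at most \<open>d\<close>. The two bounds are separate because eliminating an index turns the multipliers of
  some equations into entries of vectors. With \<open>D = d = 0\<close> the cone consists of the certificates in
  which all squares, vectors and multipliers are constant.
\<close>
inductive_set trunc_cone :: "nat \<Rightarrow> (nat \<Rightarrow> nat \<Rightarrow> rpoly) \<Rightarrow> nat set \<Rightarrow> rpoly set \<Rightarrow> nat \<Rightarrow> nat \<Rightarrow> rpoly set"
  for n L I E D d where
  zero: "0 \<in> trunc_cone n L I E D d"
| add: "g \<in> trunc_cone n L I E D d \<Longrightarrow> h \<in> trunc_cone n L I E D d \<Longrightarrow> g + h \<in> trunc_cone n L I E D d"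
| square: "p \<in> polys_upto n D \<Longrightarrow> p\<^sup>2 \<in> trunc_cone n L I E D d"
| form: "(\<And>i. i \<in> I \<Longrightarrow> v i \<in> polys_upto n D) \<Longrightarrow> bform L I v v \<in> trunc_cone n L I E D d"
| equation: "l \<in> E \<Longrightarrow> q \<in> polys_upto n d \<Longrightarrow> q * l \<in> trunc_cone n L I E D d"

lemma trunc_cone_mono:
  assumes "g \<in> trunc_cone n L I E D d" "finite I'" "I \<subseteq> I'" "E \<subseteq> E'" "D \<le> D'" "d \<le> d'"
  shows "g \<in> trunc_cone n L I' E' D' d'"
  using assms(1)
proof induction
  case (form v)
  have "bform L I' (\<lambda>i. if i \<in> I then v i else 0) (\<lambda>i. if i \<in> I then v i else 0) \<in> trunc_cone n L I' E' D' d'"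
    using form assms by (intro trunc_cone.form) (auto intro: polys_upto_mono)
  then show ?case using assms by (simp add: bform_extend)
qed (use assms in \<open>auto intro: trunc_cone.intros polys_upto_mono\<close>)

lemma trunc_cone_mult_square:
  assumes "g \<in> trunc_cone n L I E D d" "h \<in> polys_upto n k"
  shows "h\<^sup>2 * g \<in> trunc_cone n L I E (D + k) (d + 2 * k)"
  using assms(1)
proof induction
  case zero
  then show ?case by (simp add: trunc_cone.zero)
next
  case (add g1 g2)
  then show ?case by (simp add: distrib_left trunc_cone.add)
next
  case (square p)
  have "(p * h)\<^sup>2 \<in> trunc_cone n L I E (D + k) (d + 2 * k)"
    using square assms(2) by (intro trunc_cone.square polys_upto_mult)
  then show ?case by (simp add: power_mult_distrib mult.commute)
next
  case (form v)
  have "bform L I (\<lambda>i. h * v i) (\<lambda>i. h * v i) \<in> trunc_cone n L I E (D + k) (d + 2 * k)"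
    using form assms(2) by (intro trunc_cone.form) (metis mult.commute polys_upto_mult)
  then show ?case
    by (simp add: bform_scale_left bform_scale_right power2_eq_square mult.assoc)
next
  case (equation l q)
  have "h\<^sup>2 \<in> polys_upto n (2 * k)"
    using polys_upto_mult[OF assms(2) assms(2)] by (simp add: power2_eq_square mult_2)
  then have "(q * h\<^sup>2) * l \<in> trunc_cone n L I E (D + k) (d + 2 * k)"
    using equation by (intro trunc_cone.equation polys_upto_mult)
  then show ?case by (simp add: algebra_simps)
qed

lemma trunc_cone_scale:
  assumes "g \<in> trunc_cone n L I E D d" "0 \<le> c"
  shows "Const c * g \<in> trunc_cone n L I E D d"
  using trunc_cone_mult_square[OF assms(1) Const_polys_upto[of "sqrt c" n 0]] assms(2)
  by (simp flip: Const_power)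

lemma trunc_cone_sum: "(\<And>i. i \<in> A \<Longrightarrow> f i \<in> trunc_cone n L I E D d) \<Longrightarrow> sum f A \<in> trunc_cone n L I E D d"
  by (induction A rule: infinite_finite_induct) (auto intro: trunc_cone.zero trunc_cone.add)

text \<open>
  Collecting the multipliers of each equation of the family \<open>G\<close> bounds the number of terms by \<open>card J\<close>.
  The elimination of the equations costs a fixed summand for every term, so this number must be
  known before the certificate is chosen.
\<close>
lemma trunc_cone_split_equations:
  assumes "g \<in> trunc_cone n L I (E \<union> G ` J) D d" "finite J"
  obtains q where "\<And>j. j \<in> J \<Longrightarrow> q j \<in> polys_upto n d" "g - (\<Sum>j\<in>J. q j * G j) \<in> trunc_cone n L I E D d"
proof -
  have "\<exists>q. (\<forall>j\<in>J. q j \<in> polys_upto n d) \<and> g - (\<Sum>j\<in>J. q j * G j) \<in> trunc_cone n L I E D d"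
    using assms(1)
  proof induction
    case (add g h)
    then obtain q r where
      q: "\<forall>j\<in>J. q j \<in> polys_upto n d" "g - (\<Sum>j\<in>J. q j * G j) \<in> trunc_cone n L I E D d" and
      r: "\<forall>j\<in>J. r j \<in> polys_upto n d" "h - (\<Sum>j\<in>J. r j * G j) \<in> trunc_cone n L I E D d"
      by blast
    have "(g + h) - (\<Sum>j\<in>J. (q j + r j) * G j) \<in> trunc_cone n L I E D d"
      using trunc_cone.add[OF q(2) r(2)] by (simp add: algebra_simps sum.distrib)
    with q(1) r(1) show ?case by (intro exI[of _ "\<lambda>j. q j + r j"]) (auto intro: polys_upto_add)
  next
    case (equation l q)
    show ?case
    proof (cases "l \<in> E")
      case True
      then show ?thesis
        using equation by (intro exI[of _ "\<lambda>_. 0"]) (auto intro: trunc_cone.equation)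
    next
      case False
      then obtain j where j: "j \<in> J" "l = G j" using equation by blast
      have "(\<Sum>i\<in>J. (if i = j then q else 0) * G i) = (\<Sum>i\<in>J. if i = j then q * G j else 0)"
        by (intro sum.cong) auto
      also have "\<dots> = q * l" using j assms(2) by simp
      finally show ?thesis
        using equation by (intro exI[of _ "\<lambda>i. if i = j then q else 0"]) (auto intro: trunc_cone.zero)
    qed
  next
    case (form v)
    then have "bform L I v v \<in> trunc_cone n L I E D d" by (rule trunc_cone.form)
    then show ?case by (intro exI[of _ "\<lambda>_. 0"]) simp
  qed (auto intro!: exI[of _ "\<lambda>_. 0"] intro: trunc_cone.zero trunc_cone.square)
  then show thesis using that by blast
qed

text \<open>
  With no index left, a constant certificate is a nonnegative constant plus a linear combination of the
  equations, and such a combination may be multiplied by polynomials of either sign.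
\<close>
lemma trunc_cone_empty_multiple:
  assumes "g \<in> trunc_cone n L {} E 0 0"
  obtains c where "0 \<le> c" "\<And>h k. h \<in> polys_upto n k \<Longrightarrow> h * (g - Const c) \<in> trunc_cone n L {} E 0 k"
proof -
  have "\<exists>c\<ge>0. \<forall>h k. h \<in> polys_upto n k \<longrightarrow> h * (g - Const c) \<in> trunc_cone n L {} E 0 k"
    using assms
  proof induction
    case zero
    show ?case by (intro exI[of _ 0]) (auto intro: trunc_cone.zero)
  next
    case (add g g')
    then obtain c c' where
      c: "c \<ge> 0" "\<And>h k. h \<in> polys_upto n k \<Longrightarrow> h * (g - Const c) \<in> trunc_cone n L {} E 0 k" and
      c': "c' \<ge> 0" "\<And>h k. h \<in> polys_upto n k \<Longrightarrow> h * (g' - Const c') \<in> trunc_cone n L {} E 0 k"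
      by blast
    have "h * ((g + g') - Const (c + c')) \<in> trunc_cone n L {} E 0 k" if "h \<in> polys_upto n k" for h k
      using trunc_cone.add[OF c(2)[OF that] c'(2)[OF that]] by (simp add: Const_add algebra_simps)
    with c(1) c'(1) show ?case by (intro exI[of _ "c + c'"]) auto
  next
    case (square p)
    then obtain a where "p = Const a" by (auto simp: polys_upto_0_iff)
    then show ?case by (intro exI[of _ "a\<^sup>2"]) (auto simp: Const_power intro: trunc_cone.zero)
  next
    case (form v)
    show ?case by (intro exI[of _ 0]) (auto simp: bform_def intro: trunc_cone.zero)
  next
    case (equation l q)
    have "h * (q * l - Const 0) \<in> trunc_cone n L {} E 0 k" if "h \<in> polys_upto n k" for h k
      using trunc_cone.equation[OF equation(1), of "h * q" n k L "{}" 0] polys_upto_mult[OF that equation(2)]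
      by (simp add: mult.assoc)
    then show ?case by blast
  qed
  then show thesis using that by blast
qed

lemma trunc_cone_empty_all:
  assumes "- 1 \<in> trunc_cone n L {} E 0 0" "h \<in> polys_upto n k"
  shows "h \<in> trunc_cone n L {} E 0 k"
proof -
  obtain c where c: "0 \<le> c" "\<And>h k. h \<in> polys_upto n k \<Longrightarrow> h * (- 1 - Const c) \<in> trunc_cone n L {} E 0 k"
    using trunc_cone_empty_multiple[OF assms(1)] by blast
  \<comment> \<open>The combination of equations is \<open>-1 - c\<close>, a nonzero constant because \<open>c \<ge> 0\<close>.\<close>
  have "(Const (- inverse (1 + c)) * h) * (- 1 - Const c) \<in> trunc_cone n L {} E 0 k"
    by (intro c(2) polys_upto_Const_mult assms(2))
  also have "(Const (- inverse (1 + c)) * h) * (- 1 - Const c) = Const (inverse (1 + c) * (1 + c)) * h"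
    by (simp add: Const_mult Const_add Const_minus algebra_simps)
  also have "\<dots> = h" using c(1) by simp
  finally show ?thesis .
qed

lemma trunc_cone_split_single:
  assumes "g \<in> trunc_cone n L {t} E 0 0"
  obtains b where "0 \<le> b" "g - Const b * L t t \<in> trunc_cone n L {} E 0 0"
proof -
  have "\<exists>b\<ge>0. g - Const b * L t t \<in> trunc_cone n L {} E 0 0"
    using assms
  proof induction
    case (add g h)
    then obtain b c where "b \<ge> 0" "g - Const b * L t t \<in> trunc_cone n L {} E 0 0"
       "c \<ge> 0" "h - Const c * L t t \<in> trunc_cone n L {} E 0 0" by blast
    then show ?case
      using trunc_cone.add[of "g - Const b * L t t" n L "{}" E 0 0 "h - Const c * L t t"]
      by (intro exI[of _ "b + c"]) (simp add: Const_add algebra_simps)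
  next
    case (form v)
    then obtain a where a: "v t = Const a" by (auto simp: polys_upto_0_iff)
    then have "bform L {t} v v = Const (a\<^sup>2) * L t t"
      by (simp add: bform_def apply_form_def Const_mult power2_eq_square algebra_simps)
    then show ?case by (intro exI[of _ "a\<^sup>2"]) (auto intro: trunc_cone.zero)
  qed (auto intro!: exI[of _ 0] intro: trunc_cone.intros)
  then show thesis using that by blast
qed

section \<open>The alternative for infeasible pencils\<close>

definition feasible :: "nat \<Rightarrow> (nat \<Rightarrow> nat \<Rightarrow> rpoly) \<Rightarrow> nat set \<Rightarrow> rpoly set \<Rightarrow> bool" where
  "feasible n L I E \<longleftrightarrow> (\<exists>x\<in>carrier_vec n. (\<forall>l\<in>E. poly_eval l x = 0) \<and>
     (\<forall>v. 0 \<le> bform (\<lambda>i j. poly_eval (L i j) x) I v v))"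

lemma trace_peel:
  "(\<Sum>i\<in>I. \<Sum>j\<in>I. Const (B i j) * L i j)
     = (\<Sum>i\<in>I. \<Sum>j\<in>I. Const (B i j - u i * u j) * L i j) + bform L I (\<lambda>i. Const (u i)) (\<lambda>i. Const (u i))"
  unfolding bform_expand sum.distrib[symmetric]
  by (intro sum.cong) (simp_all add: Const_diff Const_mult algebra_simps)

text \<open>
  Iterating the Cholesky step decomposes \<open>B\<close> into rank-one matrices \<open>u u\<^sup>T\<close>, and the trace of
  \<open>u u\<^sup>T L\<close> is \<open>u\<^sup>T L u\<close>.
\<close>
lemma trunc_cone_trace:
  assumes "finite I" "\<forall>i\<in>I. \<forall>j\<in>I. B i j = B j i"
    and "\<And>v. 0 \<le> bform B I v v"
  shows "(\<Sum>i\<in>I. \<Sum>j\<in>I. Const (B i j) * L i j) \<in> trunc_cone n L I E 0 0"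
  using assms
proof (induction "card {k\<in>I. B k k \<noteq> 0}" arbitrary: B rule: less_induct)
  case less
  show ?case
  proof (cases "\<forall>i\<in>I. \<forall>j\<in>I. B i j = 0")
    case True
    then show ?thesis by (simp add: trunc_cone.zero)
  next
    case False
    then obtain i j where ij: "i \<in> I" "j \<in> I" "B i j \<noteq> 0" by blast
    obtain u where "\<exists>s\<in>I. u s \<noteq> 0" and u: "\<And>v. 0 \<le> bform (\<lambda>i j. B i j - u i * u j) I v v"
      "{k\<in>I. B k k - u k * u k \<noteq> 0} \<subset> {k\<in>I. B k k \<noteq> 0}"
      by (rule psd_peel[OF less.prems ij]) (rule that)
    have "(\<Sum>i\<in>I. \<Sum>j\<in>I. Const (B i j - u i * u j) * L i j) \<in> trunc_cone n L I E 0 0"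
      using less.prems u by (intro less.hyps psubset_card_mono) (auto simp: mult.commute)
    then show ?thesis
      unfolding trace_peel[of B L I u] by (intro trunc_cone.add trunc_cone.form) simp_all
  qed
qed

locale affine_pencil =
  fixes n :: nat and L :: "nat \<Rightarrow> nat \<Rightarrow> rpoly"
  assumes affine: "L i j \<in> affine_polys n" and symmetric: "L i j = L j i"
begin

lemma apply_form_affine: "apply_form L I (\<lambda>i. Const (u i)) j \<in> affine_polys n"
  unfolding apply_form_def by (intro affine_sum) (simp add: affine affine_Const_mult mult.commute)

lemma poly_eval_apply_form:
  "poly_eval (apply_form L I (\<lambda>i. Const (u i)) j) x = apply_form (\<lambda>i j. poly_eval (L i j) x) I u j"
  unfolding apply_form_def poly_eval_sum
  by (intro sum.cong) (simp_all add: mult.commute[of _ "Const _"] poly_eval_Const_mult[OF affine] mult.commute)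

lemma bform_combine_poly:
  "bform L I (\<lambda>i. a * u i + w i) (\<lambda>i. a * u i + w i)
    = a\<^sup>2 * bform L I u u + 2 * a * bform L I w u + bform L I w w"
  by (rule bform_combine) (intro ballI, rule symmetric)

text \<open>
  The set to be separated from the origin consists of all pairs of a matrix \<open>M\<close> and a vector indexed
  by \<open>E\<close> such that, for some \<open>x\<close>, the vector lists the values of the equations at \<open>x\<close> and
  the form of \<open>M\<close> is bounded by that of \<open>L(x)\<close>. It contains the origin exactly if pencil and equations are feasible.
  A functional \<open>(B, lam)\<close> that is nonpositive on this set is tested against suitable elements: adding
  multiples of skew-symmetric matrices to \<open>L(x)\<close> shows that \<open>B\<close> is symmetric, subtracting multiples of
  \<open>v v\<^sup>T\<close> that it is positive semidefinite, and \<open>L(x)\<close> itself that the resulting affine polynomial is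
  nonpositive everywhere and therefore constant.
\<close>
lemma separating_functional:
  assumes "finite I" "finite E" "E \<subseteq> affine_polys n" "\<not> feasible n L I E"
  obtains B lam c where
    "\<forall>i\<in>I. \<forall>j\<in>I. B i j = B j i" "\<And>v. 0 \<le> bform B I v v"
    "(\<Sum>i\<in>I. \<Sum>j\<in>I. Const (B i j) * L i j) + (\<Sum>l\<in>E. Const (lam l) * l) = Const c" "c \<le> 0"
    "(\<exists>i\<in>I. \<exists>j\<in>I. B i j \<noteq> 0) \<or> (\<exists>l\<in>E. lam l \<noteq> 0)"
proof -
  define ev where "ev = (\<lambda>x i j. poly_eval (L i j) x)"
  define J where "J = Inl ` (I \<times> I) \<union> (Inr ` E :: (nat \<times> nat + rpoly) set)"
  define mat_part where "mat_part = (\<lambda>(z :: nat \<times> nat + rpoly \<Rightarrow> real) i j. z (Inl (i, j)))"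
  define S where "S = {z. \<exists>x\<in>carrier_vec n. (\<forall>l\<in>E. z (Inr l) = poly_eval l x) \<and>
    (\<forall>v. bform (mat_part z) I v v \<le> bform (ev x) I v v)}"
  have SI: "case_sum (\<lambda>(i, j). M i j) (\<lambda>l. poly_eval l x) \<in> S"
    if "x \<in> carrier_vec n" "\<And>v. bform M I v v \<le> bform (ev x) I v v" for M x
    using that by (auto simp: S_def mat_part_def)
  have fin: "finite J" using assms by (simp add: J_def)
  have conv: "(\<lambda>j. (1 - t) * z j + t * z' j) \<in> S"
    if z: "z \<in> S" "z' \<in> S" and t: "0 \<le> t" "t \<le> 1" for z z' t
  proof -
    obtain x x' where x: "x \<in> carrier_vec n" "\<forall>l\<in>E. z (Inr l) = poly_eval l x"
        "\<And>v. bform (mat_part z) I v v \<le> bform (ev x) I v v"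
      and x': "x' \<in> carrier_vec n" "\<forall>l\<in>E. z' (Inr l) = poly_eval l x'"
        "\<And>v. bform (mat_part z') I v v \<le> bform (ev x') I v v"
      using z unfolding S_def by blast
    define y where "y = vec n (\<lambda>l. (1 - t) * vec_index x l + t * vec_index x' l)"
    have ev_y: "ev y = (\<lambda>i j. (1 - t) * ev x i j + t * ev x' i j)"
      using poly_eval_affine_convex[OF affine x(1) x'(1)] by (simp add: ev_def y_def)
    have "mat_part (\<lambda>j. (1 - t) * z j + t * z' j) = (\<lambda>i j. (1 - t) * mat_part z i j + t * mat_part z' i j)"
      by (simp add: mat_part_def)
    then have "bform (mat_part (\<lambda>j. (1 - t) * z j + t * z' j)) I v v \<le> bform (ev y) I v v" for v
      using x(3)[of v] x'(3)[of v] t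
      by (simp add: ev_y bform_matrix_combination add_mono mult_left_mono)
    moreover have "\<forall>l\<in>E. (1 - t) * z (Inr l) + t * z' (Inr l) = poly_eval l y"
      using poly_eval_affine_convex[OF _ x(1) x'(1)] x(2) x'(2) assms(3) by (auto simp: y_def)
    moreover have "y \<in> carrier_vec n" by (simp add: y_def)
    ultimately show ?thesis unfolding S_def by blast
  qed
  have nz: "\<exists>j\<in>J. z j \<noteq> 0" if "z \<in> S" for z
  proof (rule ccontr)
    assume "\<not> ?thesis"
    then have 0: "\<And>l. l \<in> E \<Longrightarrow> z (Inr l) = 0" "\<And>i j. i \<in> I \<Longrightarrow> j \<in> I \<Longrightarrow> mat_part z i j = 0"
      by (auto simp: J_def mat_part_def)
    have "bform (mat_part z) I v v = 0" for v
      by (simp add: bform_expand 0)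
    with \<open>z \<in> S\<close> 0(1) have "feasible n L I E"
      unfolding S_def feasible_def ev_def by fastforce
    then show False using assms(4) by simp
  qed
  have zero: "0\<^sub>v n \<in> carrier_vec n" by simp
  have "S \<noteq> {}" using SI[OF zero, of "ev (0\<^sub>v n)"] by auto
  obtain a where a: "\<exists>j\<in>J. a j \<noteq> 0" "\<And>z. z \<in> S \<Longrightarrow> 0 \<le> (\<Sum>j\<in>J. a j * z j)"
    by (rule separate_from_origin[OF fin conv nz \<open>S \<noteq> {}\<close>]) (assumption+, rule that)
  define B where "B = (\<lambda>i j. - a (Inl (i, j)))"
  define lam where "lam = (\<lambda>l. - a (Inr l))"
  have key: "(\<Sum>i\<in>I. \<Sum>j\<in>I. B i j * M i j) + (\<Sum>l\<in>E. lam l * poly_eval l x) \<le> 0"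
    if "x \<in> carrier_vec n" "\<And>v. bform M I v v \<le> bform (ev x) I v v" for M x
  proof -
    have "(\<Sum>j\<in>J. a j * case_sum (\<lambda>(i, j). M i j) (\<lambda>l. poly_eval l x) j)
        = (\<Sum>i\<in>I. \<Sum>j\<in>I. a (Inl (i, j)) * M i j) + (\<Sum>l\<in>E. a (Inr l) * poly_eval l x)"
      unfolding J_def using assms(1,2)
      by (subst sum.union_disjoint) (auto simp: sum.reindex sum.cartesian_product split_def)
    then show ?thesis
      using a(2)[OF SI[OF that]] by (simp add: B_def lam_def sum_negf)
  qed
  define K where "K = (\<Sum>i\<in>I. \<Sum>j\<in>I. B i j * ev (0\<^sub>v n) i j) + (\<Sum>l\<in>E. lam l * poly_eval l (0\<^sub>v n))"
  have skew: "bform B I p q = bform B I q p" for p q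
  proof -
    have "K + t * (bform B I p q - bform B I q p) \<le> 0" for t
    proof -
      have "bform (\<lambda>k l. ev (0\<^sub>v n) k l + t * (p k * q l - q k * p l)) I v v = bform (ev (0\<^sub>v n)) I v v" for v
      proof -
        have "(\<Sum>k\<in>I. \<Sum>l\<in>I. v k * (p k * q l) * v l) = (\<Sum>k\<in>I. v k * p k) * (\<Sum>l\<in>I. v l * q l)"
          "(\<Sum>k\<in>I. \<Sum>l\<in>I. v k * (q k * p l) * v l) = (\<Sum>k\<in>I. v k * q k) * (\<Sum>l\<in>I. v l * p l)"
          unfolding sum_product by (simp_all add: algebra_simps)
        then have "(\<Sum>k\<in>I. \<Sum>l\<in>I. v k * (p k * q l - q k * p l) * v l) = 0"
          by (simp add: algebra_simps sum_subtractf)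
        moreover have "bform (\<lambda>k l. ev (0\<^sub>v n) k l + t * (p k * q l - q k * p l)) I v v
          = bform (ev (0\<^sub>v n)) I v v + t * (\<Sum>k\<in>I. \<Sum>l\<in>I. v k * (p k * q l - q k * p l) * v l)"
          unfolding bform_expand sum_distrib_left sum.distrib[symmetric]
          by (intro sum.cong) (simp_all add: algebra_simps)
        ultimately show ?thesis by simp
      qed
      then have "(\<Sum>k\<in>I. \<Sum>l\<in>I. B k l * (ev (0\<^sub>v n) k l + t * (p k * q l - q k * p l)))
          + (\<Sum>l\<in>E. lam l * poly_eval l (0\<^sub>v n)) \<le> 0"
        by (intro key zero) simp
      moreover have "(\<Sum>k\<in>I. \<Sum>l\<in>I. B k l * (ev (0\<^sub>v n) k l + t * (p k * q l - q k * p l)))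
        = (\<Sum>k\<in>I. \<Sum>l\<in>I. B k l * ev (0\<^sub>v n) k l) + t * (bform B I p q - bform B I q p)"
        unfolding bform_expand sum_subtractf[symmetric] sum_distrib_left sum.distrib[symmetric]
        by (intro sum.cong) (simp_all add: algebra_simps)
      ultimately show ?thesis by (simp add: K_def)
    qed
    then have "bform B I p q - bform B I q p = 0" by (rule linear_bounded_above_imp_zero)
    then show ?thesis by simp
  qed
  have sym: "\<forall>i\<in>I. \<forall>j\<in>I. B i j = B j i"
  proof (intro ballI)
    fix i j assume "i \<in> I" "j \<in> I"
    then show "B i j = B j i"
      using skew[of "unit_fun i" "unit_fun j"] assms(1) by (simp add: bform_unit_left apply_form_unit)
  qed
  have psd: "0 \<le> bform B I v v" for v
  proof (rule ccontr)
    assume neg: "\<not> ?thesis"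
    \<comment> \<open>For this \<open>t\<close> the functional has the value \<open>K + \<bar>K\<bar> + 1 > 0\<close> at \<open>L(0) - t v v\<^sup>T\<close>.\<close>
    define t where "t = (\<bar>K\<bar> + 1) / (- bform B I v v)"
    have t: "t \<ge> 0" using neg unfolding t_def by (intro divide_nonneg_nonneg) auto
    have "bform (\<lambda>k l. ev (0\<^sub>v n) k l - t * (v k * v l)) I w w \<le> bform (ev (0\<^sub>v n)) I w w" for w
    proof -
      have "bform (\<lambda>k l. ev (0\<^sub>v n) k l - t * (v k * v l)) I w w = bform (ev (0\<^sub>v n)) I w w - t * (\<Sum>k\<in>I. v k * w k)\<^sup>2"
        unfolding power2_eq_square sum_product unfolding bform_expand sum_distrib_left sum_subtractf[symmetric]
        by (intro sum.cong) (simp_all add: algebra_simps)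
      then show ?thesis using t by simp
    qed
    then have "(\<Sum>k\<in>I. \<Sum>l\<in>I. B k l * (ev (0\<^sub>v n) k l - t * (v k * v l)))
        + (\<Sum>l\<in>E. lam l * poly_eval l (0\<^sub>v n)) \<le> 0"
      by (intro key zero)
    moreover have "(\<Sum>k\<in>I. \<Sum>l\<in>I. B k l * (ev (0\<^sub>v n) k l - t * (v k * v l)))
      = (\<Sum>k\<in>I. \<Sum>l\<in>I. B k l * ev (0\<^sub>v n) k l) - t * bform B I v v"
      unfolding bform_expand sum_distrib_left sum_subtractf[symmetric]
      by (intro sum.cong) (simp_all add: algebra_simps)
    ultimately have "K - t * bform B I v v \<le> 0" by (simp add: K_def)
    moreover have "- t * bform B I v v = \<bar>K\<bar> + 1" using neg by (simp add: t_def)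
    ultimately show False by simp
  qed
  define g where "g = (\<Sum>i\<in>I. \<Sum>j\<in>I. Const (B i j) * L i j) + (\<Sum>l\<in>E. Const (lam l) * l)"
  have "g \<in> affine_polys n"
    unfolding g_def using assms(3) by (intro affine_add affine_sum affine_Const_mult affine) auto
  moreover have "poly_eval g x \<le> 0" if "x \<in> carrier_vec n" for x
  proof -
    have "poly_eval (Const (lam l) * l) x = lam l * poly_eval l x" if "l \<in> E" for l
      using that assms(3) by (intro poly_eval_Const_mult) auto
    then show ?thesis
      using key[OF that, of "ev x"]
      by (simp add: g_def poly_eval_add poly_eval_sum poly_eval_Const_mult[OF affine] ev_def)
  qed
  ultimately obtain c where c: "c \<le> 0" "g = Const c"
    by (rule affine_nonpos_imp_Const)
  have "(\<exists>i\<in>I. \<exists>j\<in>I. B i j \<noteq> 0) \<or> (\<exists>l\<in>E. lam l \<noteq> 0)"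
    using a(1) by (auto simp: J_def B_def lam_def)
  from that[OF sym psd c(2)[unfolded g_def] c(1) this] show thesis .
qed

text \<open>
  Either the constant provided by the separation is negative and can be rescaled to \<open>-1\<close>, or a rank-one
  summand \<open>u u\<^sup>T\<close> of \<open>B\<close> gives \<open>- u\<^sup>T L u\<close> as the sum of the remaining terms. It may also happen that the
  functional vanishes on the matrices; it is then a linear dependency among the equations, so that one of
  them is redundant and induction on their number applies.
\<close>
lemma alternative:
  assumes "finite I" "finite E" "E \<subseteq> affine_polys n" "\<not> feasible n L I E"
  shows "- 1 \<in> trunc_cone n L I E 0 0 \<or>
    (\<exists>u. (\<exists>s\<in>I. u s \<noteq> 0) \<and> - bform L I (\<lambda>i. Const (u i)) (\<lambda>i. Const (u i)) \<in> trunc_cone n L I E 0 0)"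
  using assms(2-)
proof (induction "card E" arbitrary: E rule: less_induct)
  case less
  obtain B lam c where B: "\<forall>i\<in>I. \<forall>j\<in>I. B i j = B j i" "\<And>v. 0 \<le> bform B I v v"
    and c: "(\<Sum>i\<in>I. \<Sum>j\<in>I. Const (B i j) * L i j) + (\<Sum>l\<in>E. Const (lam l) * l) = Const c" "c \<le> 0"
    and nz: "(\<exists>i\<in>I. \<exists>j\<in>I. B i j \<noteq> 0) \<or> (\<exists>l\<in>E. lam l \<noteq> 0)"
    by (rule separating_functional[OF assms(1) less.prems]) (rule that)
  have E: "(\<Sum>l\<in>E. Const (lam l) * l) \<in> trunc_cone n L I E 0 0"
    by (intro trunc_cone_sum trunc_cone.equation) simp_all
  consider "c < 0" | i j where "c = 0" "i \<in> I" "j \<in> I" "B i j \<noteq> 0"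
    | "c = 0" "\<forall>i\<in>I. \<forall>j\<in>I. B i j = 0" using c(2) by fastforce
  then show ?case
  proof cases
    case 1
    have "Const c \<in> trunc_cone n L I E 0 0"
      unfolding c(1)[symmetric] by (intro trunc_cone.add E trunc_cone_trace assms(1) B)
    from trunc_cone_scale[OF this, of "- inverse c"] 1 show ?thesis
      by (simp add: Const_minus flip: Const_mult)
  next
    case 2
    obtain u where u: "\<exists>s\<in>I. u s \<noteq> 0" "\<And>v. 0 \<le> bform (\<lambda>i j. B i j - u i * u j) I v v"
      "{k\<in>I. B k k - u k * u k \<noteq> 0} \<subset> {k\<in>I. B k k \<noteq> 0}"
      by (rule psd_peel[OF assms(1) B 2(2-4)]) (rule that)
    have "(\<Sum>i\<in>I. \<Sum>j\<in>I. Const (B i j - u i * u j) * L i j) + (\<Sum>l\<in>E. Const (lam l) * l) \<in> trunc_cone n L I E 0 0"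
      by (intro trunc_cone.add E trunc_cone_trace assms(1) u(2)) (simp add: B(1) mult.commute)
    moreover have "(\<Sum>i\<in>I. \<Sum>j\<in>I. Const (B i j - u i * u j) * L i j) + (\<Sum>l\<in>E. Const (lam l) * l)
        = - bform L I (\<lambda>i. Const (u i)) (\<lambda>i. Const (u i))"
      using c(1) 2(1) unfolding trace_peel[of B L I u] by (simp add: algebra_simps eq_neg_iff_add_eq_0)
    ultimately have "- bform L I (\<lambda>i. Const (u i)) (\<lambda>i. Const (u i)) \<in> trunc_cone n L I E 0 0"
      by simp
    then show ?thesis using u(1) by blast
  next
    case 3
    then obtain l0 where l0: "l0 \<in> E" "lam l0 \<noteq> 0" using nz by blast
    have "(\<Sum>l\<in>E. Const (lam l) * l) = 0" using c(1) 3 by simp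
    then have dep: "Const (lam l0) * l0 + (\<Sum>l\<in>E - {l0}. Const (lam l) * l) = 0"
      using less.prems(1) l0(1) by (simp add: sum.remove)
    have "\<not> feasible n L I (E - {l0})"
    proof
      assume "feasible n L I (E - {l0})"
      then obtain x where x: "x \<in> carrier_vec n" "\<forall>l\<in>E - {l0}. poly_eval l x = 0"
        "\<forall>v. 0 \<le> bform (\<lambda>i j. poly_eval (L i j) x) I v v"
        unfolding feasible_def by blast
      have ev: "poly_eval (Const (lam l) * l) x = lam l * poly_eval l x" if "l \<in> E" for l
        using that less.prems(2) by (auto intro: poly_eval_Const_mult)
      have "poly_eval (Const (lam l0) * l0 + (\<Sum>l\<in>E - {l0}. Const (lam l) * l)) x = lam l0 * poly_eval l0 x"
        using l0(1) x(2) by (simp add: poly_eval_add poly_eval_sum ev)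
      then have "poly_eval l0 x = 0" using dep l0(2) by (simp add: poly_eval_0)
      then have "feasible n L I E" using x unfolding feasible_def by blast
      then show False using less.prems(3) by simp
    qed
    moreover have "card (E - {l0}) < card E"
      using less.prems(1) l0(1) by (rule card_Diff1_less)
    moreover have "g \<in> trunc_cone n L I E 0 0" if "g \<in> trunc_cone n L I (E - {l0}) 0 0" for g
      by (rule trunc_cone_mono[OF that]) (use assms(1) in auto)
    ultimately show ?thesis using less.hyps[of "E - {l0}"] less.prems by blast
  qed
qed

section \<open>Elimination of one index\<close>

text \<open>
  Where \<open>L u\<close> vanishes, subtracting \<open>(v\<^sub>s / u\<^sub>s) u\<close> from \<open>v\<close> does not change \<open>v\<^sup>T L v\<close> and clears the entry
  of \<open>v\<close> at \<open>s\<close>. So a feasible point of the smaller problem would be feasible for the original one.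
\<close>
lemma restrict_infeasible:
  assumes "finite I" "s \<in> I" "u s \<noteq> 0" "\<not> feasible n L I E"
  shows "\<not> feasible n L (I - {s}) (E \<union> apply_form L I (\<lambda>i. Const (u i)) ` I)"
proof
  assume "feasible n L (I - {s}) (E \<union> apply_form L I (\<lambda>i. Const (u i)) ` I)"
  then obtain x where x: "x \<in> carrier_vec n" "\<And>l. l \<in> E \<Longrightarrow> poly_eval l x = 0"
    "\<And>j. j \<in> I \<Longrightarrow> poly_eval (apply_form L I (\<lambda>i. Const (u i)) j) x = 0"
    "\<And>v. 0 \<le> bform (\<lambda>i j. poly_eval (L i j) x) (I - {s}) v v"
    unfolding feasible_def by blast
  define M where "M = (\<lambda>i j. poly_eval (L i j) x)"
  have ker: "apply_form M I u j = 0" if "j \<in> I" for j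
    using x(3)[OF that] by (simp add: poly_eval_apply_form M_def)
  have "0 \<le> bform M I v v" for v
  proof -
    define w where "w = (\<lambda>i. v i - v s / u s * u i)"
    have "bform M I v v = bform M I (\<lambda>i. v s / u s * u i + w i) (\<lambda>i. v s / u s * u i + w i)"
      by (simp add: w_def)
    also have "\<dots> = bform M I w w"
      by (subst bform_combine) (simp_all add: M_def symmetric bform_def[of _ _ _ u] ker[unfolded M_def])
    also have "\<dots> = bform M I (\<lambda>i. if i \<in> I - {s} then w i else 0) (\<lambda>i. if i \<in> I - {s} then w i else 0)"
      using assms(3) by (intro bform_cong) (auto simp: w_def)
    also have "\<dots> = bform M (I - {s}) w w"
      using assms(1) by (intro bform_extend) auto
    finally show ?thesis using x(4) by (simp add: M_def)
  qed
  with x assms(4) show False by (auto simp: feasible_def M_def)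
qed

lemma trunc_cone_isotropic_multiple:
  assumes "- bform L I (\<lambda>i. Const (u i)) (\<lambda>i. Const (u i)) \<in> trunc_cone n L I E 0 0"
  shows "Const r * bform L I (\<lambda>i. Const (u i)) (\<lambda>i. Const (u i)) \<in> trunc_cone n L I E 0 0"
proof (cases "0 \<le> r")
  case True
  then show ?thesis by (intro trunc_cone_scale trunc_cone.form) simp_all
next
  case False
  with trunc_cone_scale[OF assms, of "- r"] show ?thesis by (simp add: Const_minus)
qed

text \<open>
  The form at \<open>w = (q/2) u + e\<^sub>j\<close> equals \<open>(q/2)\<^sup>2 u\<^sup>T L u + q (L u)\<^sub>j + L\<^sub>j\<^sub>j\<close>. Its first term can be
  subtracted since \<open>- u\<^sup>T L u\<close> is in the cone, which doubles the degree of the multipliers. What remains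
  is \<open>q (L u)\<^sub>j\<close> up to the summand \<open>L\<^sub>j\<^sub>j\<close>, which the hypothesis on \<open>g\<close> compensates.
\<close>
lemma absorb_equations:
  assumes "finite I" "- bform L I (\<lambda>i. Const (u i)) (\<lambda>i. Const (u i)) \<in> trunc_cone n L I E 0 0"
    and "I' \<subseteq> I" "D \<le> d"
    and g: "g - (\<Sum>j\<in>I. L j j) \<in> trunc_cone n L I' (E \<union> apply_form L I (\<lambda>i. Const (u i)) ` I) D d"
  shows "g \<in> trunc_cone n L I E d (2 * d)"
proof -
  define U where "U = (\<lambda>i. Const (u i))"
  obtain q where q: "\<And>j. j \<in> I \<Longrightarrow> q j \<in> polys_upto n d"
    "g - (\<Sum>j\<in>I. L j j) - (\<Sum>j\<in>I. q j * apply_form L I U j) \<in> trunc_cone n L I' E D d"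
    using trunc_cone_split_equations[OF g assms(1)] by (auto simp: U_def)
  have "q j * apply_form L I U j + L j j \<in> trunc_cone n L I E d (2 * d)" if j: "j \<in> I" for j
  proof -
    define a where "a = Const (1/2) * q j"
    have a: "a \<in> polys_upto n d" unfolding a_def by (intro polys_upto_Const_mult q j)
    have a2: "2 * a = q j"
    proof -
      have "2 * a = Const (1/2 + 1/2) * q j" unfolding Const_add a_def by (simp add: algebra_simps)
      then show ?thesis by simp
    qed
    define w where "w = (\<lambda>i. a * U i + unit_fun j i)"
    have "bform L I w w = a\<^sup>2 * bform L I U U + q j * apply_form L I U j + L j j"
      unfolding w_def bform_combine_poly using assms(1) j
      by (simp add: bform_unit_left apply_form_unit a2)
    then have "q j * apply_form L I U j + L j j = bform L I w w + a\<^sup>2 * (- bform L I U U)"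
      by simp
    moreover have "a\<^sup>2 * (- bform L I U U) \<in> trunc_cone n L I E d (2 * d)"
      using trunc_cone_mult_square[OF assms(2) a] by (simp add: U_def)
    moreover have "bform L I w w \<in> trunc_cone n L I E d (2 * d)"
      unfolding w_def
      by (intro trunc_cone.form polys_upto_add)
         (auto simp: unit_fun_def U_def mult.commute[of a] intro: polys_upto_Const_mult a)
    ultimately show ?thesis by (metis trunc_cone.add)
  qed
  then have "(\<Sum>j\<in>I. q j * apply_form L I U j + L j j) \<in> trunc_cone n L I E d (2 * d)"
    by (rule trunc_cone_sum)
  moreover have "g - (\<Sum>j\<in>I. L j j) - (\<Sum>j\<in>I. q j * apply_form L I U j) \<in> trunc_cone n L I E d (2 * d)"
    by (rule trunc_cone_mono[OF q(2)]) (use assms in auto)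
  ultimately show ?thesis
    using trunc_cone.add by (fastforce simp: sum.distrib)
qed

text \<open>The identity \<open>f = (f/2 + 1)\<^sup>2 - 1 - (f/2)\<^sup>2\<close> reduces everything to the certificate of \<open>-1\<close>.\<close>
lemma strong_certificate_all:
  assumes "- 1 \<in> trunc_cone n L I E 0 0" "finite I" "f \<in> affine_polys n"
  shows "f \<in> trunc_cone n L I E 1 2"
proof -
  define h where "h = Const (1/2) * f"
  have h: "h \<in> polys_upto n 1"
    unfolding h_def by (intro polys_upto_Const_mult affine_polys_upto assms)
  have "f = h + h"
    by (simp add: h_def flip: distrib_right Const_add)
  then have "f = (h + 1)\<^sup>2 + (- 1) + h\<^sup>2 * (- 1)"
    by (simp add: power2_eq_square algebra_simps)
  moreover have "(h + 1)\<^sup>2 \<in> trunc_cone n L I E 1 2" by (intro trunc_cone.square polys_upto_add h one_polys_upto)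
  moreover have "- 1 \<in> trunc_cone n L I E 1 2" by (rule trunc_cone_mono[OF assms(1)]) (use assms in auto)
  moreover have "h\<^sup>2 * (- 1) \<in> trunc_cone n L I E 1 2" using trunc_cone_mult_square[OF assms(1) h] by (simp add: numeral_2_eq_2)
  ultimately show ?thesis by (metis trunc_cone.add)
qed

lemma extended_equations:
  assumes "finite I" "finite E" "E \<subseteq> affine_polys n"
  shows "finite (E \<union> apply_form L I (\<lambda>i. Const (u i)) ` I)"
    "E \<union> apply_form L I (\<lambda>i. Const (u i)) ` I \<subseteq> affine_polys n"
  using assms apply_form_affine by auto

section \<open>The degree bound\<close>

text \<open>
  If the alternative yields \<open>u\<close>, then the single entry of the pencil is a multiple of \<open>u\<^sup>T L u\<close>, so all
  its real multiples lie in the cone; modulo this entry the equations alone are infeasible.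
\<close>
lemma certificate_size_one:
  assumes "finite E" "E \<subseteq> affine_polys n" "\<not> feasible n L {t} E"
  shows "- 1 \<in> trunc_cone n L {t} E 0 0"
proof (rule ccontr)
  assume neg: "- 1 \<notin> trunc_cone n L {t} E 0 0"
  then obtain u where u: "u t \<noteq> 0" "- bform L {t} (\<lambda>i. Const (u i)) (\<lambda>i. Const (u i)) \<in> trunc_cone n L {t} E 0 0"
    using alternative[OF _ assms] by auto
  define G where "G = apply_form L {t} (\<lambda>i. Const (u i))"
  have inf: "\<not> feasible n L {} (E \<union> G ` {t})"
    using restrict_infeasible[where u = u and s = t and I = "{t}" and E = E] u assms by (simp add: G_def)
  have "- 1 \<in> trunc_cone n L {} (E \<union> G ` {t}) 0 0"
    using alternative[OF _ _ _ inf] extended_equations[of "{t}" E u] assms by (auto simp: G_def)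
  then obtain q where q: "q t \<in> polys_upto n 0" "- 1 - q t * G t \<in> trunc_cone n L {} E 0 0"
    by (rule trunc_cone_split_equations) auto
  then obtain a where a: "q t = Const a" by (auto simp: polys_upto_0_iff)
  have "q t * G t = Const (a / u t) * bform L {t} (\<lambda>i. Const (u i)) (\<lambda>i. Const (u i))"
  proof -
    have "Const (a / u t) * bform L {t} (\<lambda>i. Const (u i)) (\<lambda>i. Const (u i)) = Const (a / u t * u t) * G t"
      unfolding bform_def G_def Const_mult by (simp only: mult.assoc sum.insert sum.empty finite.emptyI empty_iff add_0_right simp_thms)
    then show ?thesis using u(1) a by simp
  qed
  then have "q t * G t \<in> trunc_cone n L {t} E 0 0" using trunc_cone_isotropic_multiple[OF u(2)] by simp
  moreover have "- 1 - q t * G t \<in> trunc_cone n L {t} E 0 0"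
    by (rule trunc_cone_mono[OF q(2)]) auto
  ultimately show False using trunc_cone.add neg by fastforce
qed

text \<open>
  Deleting \<open>s\<close> leaves a pencil of size one, for which \<open>-1 = r + b L\<^sub>t\<^sub>t + \<mu>\<^sub>s (L u)\<^sub>s + \<mu>\<^sub>t (L u)\<^sub>t\<close> with constants
  \<open>b \<ge> 0\<close>, \<open>\<mu>\<^sub>s\<close>, \<open>\<mu>\<^sub>t\<close>, where \<open>r\<close> is a nonnegative constant plus a combination of the equations.
  If \<open>b = 0\<close>, this is a certificate by equations, so that any affine polynomial is a combination of the equations with multipliers of degree 1. If \<open>b > 0\<close>,
  a multiple of \<open>u\<^sup>T L u = u\<^sub>s (L u)\<^sub>s + u\<^sub>t (L u)\<^sub>t\<close> eliminates \<open>(L u)\<^sub>s\<close>, and the remaining terms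
  \<open>b L\<^sub>t\<^sub>t + g (L u)\<^sub>t\<close> are completed to the form at \<open>al u + sqrt b e\<^sub>t\<close>. Then \<open>-1\<close> has a certificate with constant
  vectors for the given pencil. Using \<open>strong_certificate_all\<close> before the elimination instead would give
  degree 2.
\<close>
lemma affine_certificate_size_two:
  assumes "finite E" "E \<subseteq> affine_polys n" "\<not> feasible n L {s, t} E" "s \<noteq> t"
    and u: "u s \<noteq> 0" "- bform L {s, t} (\<lambda>i. Const (u i)) (\<lambda>i. Const (u i)) \<in> trunc_cone n L {s, t} E 0 0"
    and f: "f \<in> affine_polys n"
  shows "f \<in> trunc_cone n L {s, t} E 1 2"
proof -
  define U where "U = (\<lambda>i. Const (u i))"
  define I where "I = {s, t}"
  define G where "G = apply_form L I U"
  have I: "finite I" "I - {s} = {t}" using assms(4) by (auto simp: I_def)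
  have inf: "\<not> feasible n L {t} (E \<union> G ` I)"
    using restrict_infeasible[where u = u and s = s and I = I and E = E] I u assms by (simp add: G_def I_def U_def)
  have cert: "- 1 \<in> trunc_cone n L {t} (E \<union> G ` I) 0 0"
    using extended_equations[of I E u] I assms inf by (intro certificate_size_one) (auto simp: G_def U_def)
  then obtain q where q: "\<And>j. j \<in> I \<Longrightarrow> q j \<in> polys_upto n 0" "- 1 - (\<Sum>j\<in>I. q j * G j) \<in> trunc_cone n L {t} E 0 0"
    using trunc_cone_split_equations[OF cert I(1)] by blast
  obtain b where b: "0 \<le> b" "- 1 - (\<Sum>j\<in>I. q j * G j) - Const b * L t t \<in> trunc_cone n L {} E 0 0"
    using trunc_cone_split_single[OF q(2)] by blast
  obtain ms mt where m: "q s = Const ms" "q t = Const mt"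
    using q(1)[of s] q(1)[of t] by (auto simp: I_def polys_upto_0_iff)
  show ?thesis
  proof (cases "b = 0")
    case True
    have "- 1 - (\<Sum>j\<in>I. q j * G j) \<in> trunc_cone n L {} (E \<union> G ` I) 0 0"
      using trunc_cone_mono[OF b(2), of "{}" "E \<union> G ` I" 0 0] True by simp
    moreover have "(\<Sum>j\<in>I. q j * G j) \<in> trunc_cone n L {} (E \<union> G ` I) 0 0"
      by (intro trunc_cone_sum trunc_cone.equation q(1)) auto
    ultimately have "- 1 \<in> trunc_cone n L {} (E \<union> G ` I) 0 0" using trunc_cone.add by fastforce
    then have "f - (\<Sum>j\<in>I. L j j) \<in> trunc_cone n L {} (E \<union> G ` I) 0 1"
    proof (rule trunc_cone_empty_all)
      have "f + - (\<Sum>j\<in>I. L j j) \<in> affine_polys n" by (intro affine_add affine_minus affine_sum affine f)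
      then show "f - (\<Sum>j\<in>I. L j j) \<in> polys_upto n 1" using affine_polys_upto by fastforce
    qed
    then have "f \<in> trunc_cone n L I E 1 (2 * 1)"
      using u(2) I(1) by (intro absorb_equations[where I' = "{}" and D = 0]) (auto simp: G_def U_def I_def)
    then show ?thesis by (simp add: I_def)
  next
    case False
    then have b0: "b > 0" using b(1) by simp
    \<comment> \<open>The coefficient \<open>k\<close> makes \<open>k u\<^sup>T L u\<close> cancel \<open>ms (L u)\<^sub>s\<close>; the coefficient \<open>g\<close> of \<open>(L u)\<^sub>t\<close> is what
      is left, and \<open>2 al sqrt b = g\<close>.\<close>
    define k where "k = ms / u s"
    define g where "g = mt - k * u t"
    define al where "al = g / (2 * sqrt b)"
    have uLu: "bform L I U U = Const (u s) * G s + Const (u t) * G t"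
      using assms(4) by (simp add: bform_def I_def G_def U_def)
    define w where "w = (\<lambda>i. Const al * U i + Const (sqrt b) * unit_fun t i)"
    have "bform L I w w = (Const al)\<^sup>2 * bform L I U U + 2 * Const al * (Const (sqrt b) * G t) + Const (sqrt b) * (Const (sqrt b) * L t t)"
      unfolding w_def bform_combine_poly bform_scale_left bform_scale_right using I
      by (simp add: bform_unit_left apply_form_unit I_def G_def)
    also have "\<dots> = Const (al\<^sup>2) * bform L I U U + Const (al * sqrt b + al * sqrt b) * G t + Const (sqrt b * sqrt b) * L t t"
      unfolding Const_power Const_mult Const_add by (simp add: algebra_simps)
    also have "al * sqrt b + al * sqrt b = g" using b0 by (simp add: al_def)
    also have "sqrt b * sqrt b = b" using b0 by simp
    finally have w: "bform L I w w = Const (al\<^sup>2) * bform L I U U + Const g * G t + Const b * L t t" .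
    have "Const ms * G s + Const mt * G t = Const k * bform L I U U + Const g * G t"
    proof -
      have "Const k * bform L I U U + Const g * G t = Const (k * u s) * G s + Const (k * u t + g) * G t"
        unfolding uLu Const_mult Const_add by (simp add: algebra_simps)
      then show ?thesis using u(1) by (simp add: k_def g_def)
    qed
    then have eq: "(- 1 - (\<Sum>j\<in>I. q j * G j) - Const b * L t t) + bform L I w w + Const (k - al\<^sup>2) * bform L I U U = - 1"
      using assms(4) unfolding w Const_diff by (simp add: I_def m algebra_simps)
    have "- 1 - (\<Sum>j\<in>I. q j * G j) - Const b * L t t \<in> trunc_cone n L I E 0 0"
      by (rule trunc_cone_mono[OF b(2)]) (use I in auto)
    moreover have "bform L I w w \<in> trunc_cone n L I E 0 0"
      unfolding w_def U_def unit_fun_def by (intro trunc_cone.form polys_upto_add) (auto simp flip: Const_mult)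
    moreover have "Const (k - al\<^sup>2) * bform L I U U \<in> trunc_cone n L I E 0 0"
      using trunc_cone_isotropic_multiple u(2) by (simp add: I_def U_def)
    ultimately have "(- 1 - (\<Sum>j\<in>I. q j * G j) - Const b * L t t) + bform L I w w + Const (k - al\<^sup>2) * bform L I U U \<in> trunc_cone n L I E 0 0"
      by (intro trunc_cone.add)
    then have "- 1 \<in> trunc_cone n L I E 0 0" unfolding eq .
    then show ?thesis using strong_certificate_all[OF _ I(1) f] by (simp add: I_def)
  qed
qed

text \<open>
  The exponent counts the deletions down to size two, each of which doubles the degree.
\<close>
lemma affine_certificate:
  assumes "finite I" "card I = N + 2" "finite E" "E \<subseteq> affine_polys n" "\<not> feasible n L I E" "f \<in> affine_polys n"
  shows "f \<in> trunc_cone n L I E (2 ^ N) (2 * 2 ^ N)"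
  using assms
proof (induction N arbitrary: I E f)
  case 0
  then obtain s t where st: "I = {s, t}" "s \<noteq> t" by (auto simp: card_2_iff numeral_2_eq_2[symmetric])
  from alternative[OF 0(1,3,4,5)] consider "- 1 \<in> trunc_cone n L I E 0 0"
    | u where "u s \<noteq> 0" "- bform L I (\<lambda>i. Const (u i)) (\<lambda>i. Const (u i)) \<in> trunc_cone n L I E 0 0"
    | u where "u t \<noteq> 0" "- bform L I (\<lambda>i. Const (u i)) (\<lambda>i. Const (u i)) \<in> trunc_cone n L I E 0 0"
    using st by blast
  then have "f \<in> trunc_cone n L I E 1 2"
  proof cases
    case 1
    then show ?thesis by (intro strong_certificate_all 0)
  next
    case 2
    then show ?thesis using 0 st affine_certificate_size_two[of E s t u f] by simp
  next
    case 3
    then show ?thesis using 0 st affine_certificate_size_two[of E t s u f] by (simp add: insert_commute)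
  qed
  then show ?case by simp
next
  case (Suc N)
  from alternative[OF Suc.prems(1,3,4,5)] show ?case
  proof (elim disjE exE conjE bexE)
    assume "- 1 \<in> trunc_cone n L I E 0 0"
    then have "f \<in> trunc_cone n L I E 1 2" by (intro strong_certificate_all Suc.prems)
    then show ?thesis by (rule trunc_cone_mono) (use Suc.prems in auto)
  next
    fix u s
    assume u: "s \<in> I" "u s \<noteq> 0" "- bform L I (\<lambda>i. Const (u i)) (\<lambda>i. Const (u i)) \<in> trunc_cone n L I E 0 0"
    have "f + - (\<Sum>j\<in>I. L j j) \<in> affine_polys n"
      by (intro affine_add affine_minus affine_sum affine Suc.prems)
    then have "f - (\<Sum>j\<in>I. L j j) \<in> trunc_cone n L (I - {s}) (E \<union> apply_form L I (\<lambda>i. Const (u i)) ` I) (2 ^ N) (2 * 2 ^ N)"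
      using Suc.prems u extended_equations[of I E u]
      by (intro Suc.IH restrict_infeasible) auto
    then have "f \<in> trunc_cone n L I E (2 * 2 ^ N) (2 * (2 * 2 ^ N))"
      using Suc.prems u by (intro absorb_equations[where I' = "I - {s}"]) auto
    then show ?thesis by simp
  qed
qed

end

section \<open>Certificates for pencils\<close>

lemma scalar_prod_mult_mat_vec:
  assumes "M \<in> carrier_mat m m" "v \<in> carrier_vec m"
    and "\<And>i j. i < m \<Longrightarrow> j < m \<Longrightarrow> N i j = M $$ (i, j)"
  shows "scalar_prod v (mult_mat_vec M v) = bform N {..<m} (vec_index v) (vec_index v)"
  using assms by (simp add: scalar_prod_def bform_def apply_form_def atLeast0LessThan)

lemma trunc_cone_subset_trunc_quadratic_module:
  assumes L: "L \<in> carrier_mat m m" and P: "\<And>i j. i < m \<Longrightarrow> j < m \<Longrightarrow> P i j = L $$ (i, j)"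
    and "g \<in> trunc_cone n P {..<m} {} k d"
  shows "g \<in> trunc_quadratic_module n m L k"
  using assms(3)
proof induction
  case zero
  show ?case unfolding trunc_quadratic_module_def
    by (rule CollectI, rule exI[of _ "[]"], rule exI[of _ "[]"]) simp
next
  case (add g h)
  then obtain ps vs qs ws where
    "g = (\<Sum>p\<leftarrow>ps. p ^ 2) + (\<Sum>v\<leftarrow>vs. scalar_prod v (mult_mat_vec L v))"
    "h = (\<Sum>p\<leftarrow>qs. p ^ 2) + (\<Sum>v\<leftarrow>ws. scalar_prod v (mult_mat_vec L v))"
    "set (ps @ qs) \<subseteq> polys_upto n k"
    "set (vs @ ws) \<subseteq> {v \<in> carrier_vec m. \<forall>i<m. vec_index v i \<in> polys_upto n k}"
    unfolding trunc_quadratic_module_def by auto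
  then show ?case unfolding trunc_quadratic_module_def
    by (intro CollectI exI[of _ "ps @ qs"] exI[of _ "vs @ ws"]) simp
next
  case (square p)
  then show ?case unfolding trunc_quadratic_module_def
    by (intro CollectI exI[of _ "[p]"] exI[of _ "[]"]) simp
next
  case (form v)
  have "bform P {..<m} v v = bform P {..<m} (vec_index (vec m v)) (vec_index (vec m v))"
    by (rule bform_cong) simp_all
  also have "\<dots> = scalar_prod (vec m v) (mult_mat_vec L (vec m v))"
    using scalar_prod_mult_mat_vec[OF L _ P, of "vec m v"] by simp
  finally show ?case using form unfolding trunc_quadratic_module_def
    by (intro CollectI exI[of _ "[]"] exI[of _ "[vec m v]"]) simp
qed simp

theorem theorem2p3p2:
  fixes n m :: nat and L :: "rpoly mat"
  assumes "linear_pencil n m L"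
    and "spectrahedron n L = {}"
  shows "- 1 \<in> trunc_quadratic_module n m L (2 ^ (m - 1) - 1)"
proof -
  obtain A0 A where A: "sym_mat m A0" "\<And>l. l < n \<Longrightarrow> sym_mat m (A l)" "L = pencil_of n m A0 A"
    using assms(1) by (auto simp: linear_pencil_def)
  have sym: "M $$ (i, j) = M $$ (j, i)" if "sym_mat m M" "i < m" "j < m" for M i j
    using that unfolding sym_mat_def by (metis carrier_matD index_transpose_mat(1))
  have L: "L \<in> carrier_mat m m" by (simp add: A(3) pencil_of_def)
  \<comment> \<open>Entries outside the matrix are unspecified; setting them to zero makes \<open>P\<close> symmetric and affine
    at all indices.\<close>
  define P where "P = (\<lambda>i j. if i < m \<and> j < m then L $$ (i, j) else 0)"
  interpret affine_pencil n P
  proof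
    fix i j
    show "P i j \<in> affine_polys n" by (auto simp: P_def A(3) pencil_of_def affine_polysI)
    show "P i j = P j i"
      using sym[OF A(1), of i j] sym[OF A(2), of _ i j] by (simp add: P_def A(3) pencil_of_def)
  qed
  have infeasible: "\<not> feasible n P {..<m} {}"
  proof
    assume "feasible n P {..<m} {}"
    then obtain x where x: "x \<in> carrier_vec n" "\<And>v. 0 \<le> bform (\<lambda>i j. poly_eval (P i j) x) {..<m} v v"
      by (auto simp: feasible_def)
    define M where "M = pencil_eval L x"
    have M: "M \<in> carrier_mat m m" using L by (simp add: M_def pencil_eval_def)
    have entry: "poly_eval (P i j) x = M $$ (i, j)" if "i < m" "j < m" for i j
      using that L by (simp add: M_def pencil_eval_def P_def)
    have "transpose_mat M = M"
    proof (rule eq_matI)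
      fix i j assume "i < dim_row M" "j < dim_col M"
      then have "i < m" "j < m" using M by auto
      then show "transpose_mat M $$ (i, j) = M $$ (i, j)"
        using M entry[of i j] entry[of j i] symmetric[of i j] by simp
    qed (use M in auto)
    moreover have "0 \<le> scalar_prod v (mult_mat_vec M v)" if "v \<in> carrier_vec m" for v
      using scalar_prod_mult_mat_vec[OF M that entry] x(2) by simp
    ultimately have "psd M" using M by (auto simp: psd_def sym_mat_def)
    then show False using assms(2) x(1) by (auto simp: spectrahedron_def M_def)
  qed
  have "\<exists>d. - 1 \<in> trunc_cone n P {..<m} {} (2 ^ (m - 1) - 1) d"
  proof -
    consider "m = 0" | "m = 1" | N where "m = N + 2"
      by (metis One_nat_def add_2_eq_Suc' not0_implies_Suc)
    then show ?thesis
    proof cases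
      case 1
      have "feasible n P {..<m} {}"
        unfolding feasible_def using 1 by (intro bexI[of _ "0\<^sub>v n"]) (simp_all add: bform_def)
      then show ?thesis using infeasible by simp
    next
      case 2
      then have "{..<m} = {0}" by auto
      then show ?thesis
        using certificate_size_one[of "{}" 0] infeasible 2 by auto
    next
      case 3
      have "- 1 \<in> affine_polys n" using Const_affine[of "-1"] by (simp add: Const_minus)
      then have "- 1 \<in> trunc_cone n P {..<m} {} (2 ^ N) (2 * 2 ^ N)"
        using 3 infeasible by (intro affine_certificate) auto
      moreover have "(2::nat) ^ N \<le> 2 ^ (m - 1) - 1"
      proof -
        have "(1::nat) \<le> 2 ^ N" by simp
        then have "(2::nat) ^ N + 1 \<le> 2 ^ (m - 1)" using 3 by simp
        then show ?thesis by simp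
      qed
      ultimately show ?thesis using trunc_cone_mono by blast
    qed
  qed
  then show ?thesis
    using trunc_cone_subset_trunc_quadratic_module[OF L, of P] by (auto simp: P_def)
qed

end
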